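(* Let $m\ge 2$, $0<\rho<1$ and $a_1,\dots,a_m\in\mathbb{R}$, and let $E\subset\mathbb{R}$ be the self-similar set generated by the homogeneous iterated function system $\Phi=\{\phi_i(x)=\rho x+a_i\}_{i=1}^m$. Assume that $\Phi$ satisfies the open set condition and that $\dim_{\rm H}E<1$. Let $f:\mathbb{R}\to\mathbb{R}$ be a $C^1$-diffeomorphism of $\mathbb{R}$. Suppose that $$\frac{\log|f'(x)|}{\log\rho}\notin\mathbb{Q}\qquad\text{for every }x\in E\cap f^{-1}(E).$$ Then $$\overline{\dim}_{\rm M}(f(E)\cap E)<\dim_{\rm H}E.$$
   Context: The self-similar set generated by $\Phi=\{\phi_i\}_{i=1}^m$ is the unique non-empty compact set $E\subset\mathbb{R}$ with $E=\bigcup_{i=1}^m\phi_i(E)$. $\Phi$ satisfies the open set condition (OSC) if there is a non-empty bounded open set $V\subset\mathbb{R}$ such that $\phi_1(V),\dots,\phi_m(V)$ are pairwise disjoint and contained in $V$. $\dim_{\rm H}$ denotes Hausdorff dimension. For a non-empty bounded $A\subset\mathbb{R}$, the upper Minkowski dimension is $\overline{\dim}_{\rm M}A=\limsup_{\delta\to0}\frac{\log N_\delta(A)}{-\log\delta}$, where $N_\delta(A)$ is the smallest number of closed intervals of length $\delta$ needed to cover $A$. Convention: $\overline{\dim}_{\rm M}\emptyset=\dim_{\rm H}\emptyset=0$. *)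

theory Defs
  imports "HOL-Analysis.Analysis"
begin

section \<open>Iterated function systems\<close>

text \<open>The system is a family over an index set, so that coinciding maps are counted separately.\<close>

text \<open>For a finite non-empty family of contractions of a complete space, the following
  predicate determines \<open>E\<close> uniquely.\<close>

definition self_similar_set :: "'i set \<Rightarrow> ('i \<Rightarrow> real \<Rightarrow> real) \<Rightarrow> real set \<Rightarrow> bool" where
  "self_similar_set I \<phi> E \<longleftrightarrow> compact E \<and> E \<noteq> {} \<and> E = (\<Union>i\<in>I. \<phi> i ` E)"

definition open_set_condition :: "'i set \<Rightarrow> ('i \<Rightarrow> real \<Rightarrow> real) \<Rightarrow> bool" where
  "open_set_condition I \<phi> \<longleftrightarrow>
     (\<exists>V. V \<noteq> {} \<and> bounded V \<and> open V \<and>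
          (\<forall>i\<in>I. \<phi> i ` V \<subseteq> V) \<and> disjoint_family_on (\<lambda>i. \<phi> i ` V) I)"

section \<open>Hausdorff dimension\<close>

text \<open>The \<open>s\<close>-th power of the diameter, with \<open>0\<^sup>0 = 1\<close> for non-empty sets (whereas \<open>powr\<close>
  has \<open>0 powr 0 = 0\<close>) and value \<open>0\<close> for the empty set.\<close>

definition diam_pow :: "real \<Rightarrow> 'a::metric_space set \<Rightarrow> ennreal" where
  "diam_pow s U = (if U = {} then 0 else if s = 0 then 1 else ennreal (diameter U powr s))"

text \<open>Boundedness is required explicitly because the library's \<open>diameter\<close> is only meaningful for
  bounded sets. Finite covers are included, since the members of a cover may be empty.\<close>

definition hausdorff_premeasure :: "real \<Rightarrow> real \<Rightarrow> 'a::metric_space set \<Rightarrow> ennreal" where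
  "hausdorff_premeasure s \<delta> A =
     (INF U \<in> {U :: nat \<Rightarrow> 'a set.
                 A \<subseteq> (\<Union>i. U i) \<and> (\<forall>i. bounded (U i) \<and> diameter (U i) \<le> \<delta>)}.
        \<Sum>i. diam_pow s (U i))"

definition hausdorff_measure :: "real \<Rightarrow> 'a::metric_space set \<Rightarrow> ennreal" where
  "hausdorff_measure s A = (SUP \<delta>\<in>{0<..}. hausdorff_premeasure s \<delta> A)"

definition hausdorff_dim :: "'a::metric_space set \<Rightarrow> ereal" where
  "hausdorff_dim A = (INF s \<in> {s. 0 \<le> s \<and> hausdorff_measure s A = 0}. ereal s)"

section \<open>Upper Minkowski dimension\<close>

text \<open>The finite set \<open>T\<close> consists of the left end points of the covering intervals. The value is
  meaningful for bounded \<open>A\<close> and \<open>\<delta> > 0\<close> only.\<close>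

definition covering_number :: "real \<Rightarrow> real set \<Rightarrow> nat" where
  "covering_number \<delta> A =
     (LEAST n. \<exists>T. finite T \<and> card T = n \<and> A \<subseteq> (\<Union>t\<in>T. {t..t + \<delta>}))"

definition upper_minkowski_dim :: "real set \<Rightarrow> ereal" where
  "upper_minkowski_dim A =
     (if A = {} then 0
      else Limsup (at_right 0) (\<lambda>\<delta>. ereal (ln (real (covering_number \<delta> A)) / - ln \<delta>)))"

section \<open>Diffeomorphisms of the line\<close>

definition C1_diffeomorphism :: "(real \<Rightarrow> real) \<Rightarrow> bool" where
  "C1_diffeomorphism f \<longleftrightarrow>
     bij f \<and> f C1_differentiable_on UNIV \<and> inv f C1_differentiable_on UNIV"

end

(*
  Counting nodes of the coding tree shows that f(E) can meet E in full dimension only if there are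
  cylinders of E, arbitrarily small, all of whose subcylinders up to an arbitrary relative depth meet
  f(E).  Zooming in at them and passing to a limit, E is covered by finitely many affine copies of
  itself with slope f'(x) for some x in E with f(x) in E.  By a Baire argument one copy contains a
  cylinder, so some psi(x) = r x + c with log |r| / log rho irrational maps E into E; replacing psi by
  its square, r > 0.  The sets psi^-n(E) increase with n.  Choose n and k with rho^k / r^n close to,
  but different from, 1: within a fixed bounded window, psi^-n(E) is a union of boundedly many copies
  of E with slope rho^k / r^n.  Hence in some open interval the closure U of the union of all psi^-n(E)
  lies in a translate of E and is mapped into U by affine maps arbitrarily close to, but different
  from, the identity.  The orbits of such maps leave only arbitrarily small gaps, so U, hence E,
  contains an interval.  This contradicts dim E < 1.
*)

theory Submission
  imports Defs
begin

section \<open>Homogeneous systems with the open set condition\<close>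

text \<open>The similarity dimension links the two dimensions. Pruning the coding tree gives an
  upper Minkowski dimension strictly below \<open>sim_dim\<close>, and a count of words gives
  \<open>sim_dim \<le> hausdorff_dim E\<close>. The latter also turns
  \<open>hausdorff_dim E < 1\<close> into \<open>m * \<rho> < 1\<close>, hence into Lebesgue nullity
  of \<open>E\<close>, the form in which an interval inside \<open>E\<close> is refuted.

  The open set condition acts through one bound: an interval of length comparable to
  \<open>\<rho> ^ n\<close> meets boundedly many cylinders of level \<open>n\<close>, uniformly in
  \<open>n\<close>. So every zoom shows at most \<open>M\<close> affine copies of \<open>E\<close>;
  their translations, listed as \<open>M\<close>-tuples in a compact box, converge along a
  subsequence, and the limit is again a finite union of copies.

  Two things could spoil the final orbit argument. The slope \<open>\<rho> ^ k / r ^ n\<close> might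
  equal 1 and the map be the identity: irrationality forbids this. Or the orbit might stall at the
  fixed point of the map, whose position is not under control: two disjoint intervals are kept in
  play, and the fixed point misses one of them.\<close>

locale homogeneous_ifs =
  fixes m :: nat and \<rho> :: real and a :: "nat \<Rightarrow> real" and E :: "real set"
  assumes m_ge: "m \<ge> 2"
    and \<rho>_pos: "0 < \<rho>" and \<rho>_less: "\<rho> < 1"
    and attractor: "self_similar_set {1..m} (\<lambda>i x. \<rho> * x + a i) E"
    and osc: "open_set_condition {1..m} (\<lambda>i x. \<rho> * x + a i)"
begin

definition words :: "nat \<Rightarrow> nat list set" where
  "words n = {w. set w \<subseteq> {1..m} \<and> length w = n}"

fun offset :: "nat list \<Rightarrow> real" where
  "offset [] = 0"
| "offset (i # w) = a i + \<rho> * offset w"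

text \<open>The composition along \<open>w\<close> with the first letter outermost, so that a prefix
  names a larger cylinder. Homogeneity makes the slope depend on the length of \<open>w\<close>
  only.\<close>

definition wmap :: "nat list \<Rightarrow> real \<Rightarrow> real" where
  "wmap w x = \<rho> ^ length w * x + offset w"

text \<open>The similarity dimension, that is, the root \<open>s\<close> of
  \<open>m * \<rho> powr s = 1\<close>.\<close>

definition sim_dim :: real where
  "sim_dim = ln (real m) / - ln \<rho>"

lemma compact_E: "compact E" and E_nonempty: "E \<noteq> {}"
  and E_eq: "E = (\<Union>i\<in>{1..m}. (\<lambda>x. \<rho> * x + a i) ` E)"
  using attractor by (auto simp: self_similar_set_def)

lemma wmap_Nil [simp]: "wmap [] = id"
  by (auto simp: wmap_def)

lemma wmap_Cons: "wmap (i # w) x = \<rho> * wmap w x + a i"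
  by (simp add: wmap_def algebra_simps)

lemma wmap_append: "wmap (u @ v) x = wmap u (wmap v x)"
  by (induction u) (simp_all add: wmap_Cons)

lemma words_0 [simp]: "words 0 = {[]}"
  by (auto simp: words_def)

lemma finite_words [simp]: "finite (words n)"
  unfolding words_def by (rule finite_lists_length_eq) simp

lemma card_words: "card (words n) = m ^ n"
  unfolding words_def by (subst card_lists_length_eq) simp_all

lemma words_Suc: "words (Suc n) = (\<lambda>(i, w). i # w) ` ({1..m} \<times> words n)"
  by (auto simp: words_def length_Suc_conv image_iff)

lemma length_words: "w \<in> words n \<Longrightarrow> length w = n"
  by (simp add: words_def)

lemma append_words: "u \<in> words k \<Longrightarrow> v \<in> words n \<Longrightarrow> u @ v \<in> words (k + n)"
  by (auto simp: words_def)

lemma E_eq_words: "E = (\<Union>w\<in>words n. wmap w ` E)"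
proof (induction n)
  case (Suc n)
  have "E = (\<Union>i\<in>{1..m}. (\<lambda>x. \<rho> * x + a i) ` E)"
    by (rule E_eq)
  also have "\<dots> = (\<Union>i\<in>{1..m}. (\<lambda>x. \<rho> * x + a i) ` (\<Union>w\<in>words n. wmap w ` E))"
    using Suc by simp
  also have "\<dots> = (\<Union>w\<in>words (Suc n). wmap w ` E)"
    unfolding words_Suc by (force simp: wmap_Cons)
  finally show ?case .
qed simp

lemma wmap_in_E: "w \<in> words n \<Longrightarrow> x \<in> E \<Longrightarrow> wmap w x \<in> E"
  using E_eq_words[of n] by blast

lemma obtain_word:
  assumes "x \<in> E"
  obtains w y where "w \<in> words n" "y \<in> E" "x = wmap w y"
  using assms E_eq_words[of n] by blast

lemma E_bounded: obtains R where "R > 0" "\<And>x. x \<in> E \<Longrightarrow> \<bar>x\<bar> \<le> R"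
proof -
  obtain B where "\<forall>x\<in>E. norm x \<le> B" "B > 0"
    using compact_imp_bounded[OF compact_E] bounded_pos by metis
  then show ?thesis using that by auto
qed

text \<open>The open sets \<open>wmap w ` V\<close> of one level are disjoint and contain intervals of comparable
  length, so only boundedly many fit near an interval of that length.\<close>

lemma card_words_near_interval:
  obtains M where
    "\<And>n x. card {w \<in> words n. wmap w ` E \<inter> {x..x + L * \<rho> ^ n} \<noteq> {}} \<le> M"
proof -
  obtain V where V: "V \<noteq> {}" "bounded V" "open V"
    "\<And>i. i \<in> {1..m} \<Longrightarrow> (\<lambda>x. \<rho> * x + a i) ` V \<subseteq> V"
    and disj: "disjoint_family_on (\<lambda>i. (\<lambda>x. \<rho> * x + a i) ` V) {1..m}"
    using osc unfolding open_set_condition_def by blast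
  have sub: "wmap w ` V \<subseteq> V" if "w \<in> words n" for w n
    using that
  proof (induction n arbitrary: w)
    case (Suc n)
    then obtain i v where w: "w = i # v" "i \<in> {1..m}" "v \<in> words n"
      by (auto simp: words_Suc)
    then show ?case using Suc.IH[of v] V(4)[of i] by (auto simp: wmap_Cons)
  qed simp
  have dis: "wmap w ` V \<inter> wmap w' ` V = {}" if "w \<in> words n" "w' \<in> words n" "w \<noteq> w'" for w w' n
    using that
  proof (induction n arbitrary: w w')
    case (Suc n)
    obtain i v where w: "w = i # v" "i \<in> {1..m}" "v \<in> words n"
      using Suc.prems(1) by (auto simp: words_Suc)
    obtain i' v' where w': "w' = i' # v'" "i' \<in> {1..m}" "v' \<in> words n"
      using Suc.prems(2) by (auto simp: words_Suc)
    note w = w w'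
    show ?case
    proof (cases "i = i'")
      case True
      then have "wmap v ` V \<inter> wmap v' ` V = {}"
        using Suc.IH[of v v'] Suc.prems(3) w by simp
      then have "wmap v x \<noteq> wmap v' y" if "x \<in> V" "y \<in> V" for x y
        using that by blast
      then show ?thesis using w True \<rho>_pos by (auto simp: wmap_Cons)
    next
      case False
      then have "(\<lambda>x. \<rho> * x + a i) ` V \<inter> (\<lambda>x. \<rho> * x + a i') ` V = {}"
        using disj w by (auto simp: disjoint_family_on_def)
      moreover have "wmap v x \<in> V" "wmap v' x \<in> V" if "x \<in> V" for x
        using sub[OF w(3)] sub[OF w(6)] that by blast+
      ultimately show ?thesis unfolding w(1,4) by (auto simp: wmap_Cons)
    qed
  qed simp
  obtain v0 where "v0 \<in> V" using V by blast
  then obtain \<eta> where \<eta>: "\<eta> > 0" "ball v0 \<eta> \<subseteq> V"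
    using V(3) open_contains_ball by blast
  obtain R where R: "R > 0" "\<And>x. x \<in> E \<Longrightarrow> \<bar>x\<bar> \<le> R" by (rule E_bounded) auto
  \<comment> \<open>\<open>E\<close> need not lie in \<open>V\<close>; \<open>R'\<close> bounds the
    distance from \<open>v0\<close> to every point of \<open>E\<close>.\<close>
  define R' where "R' = R + \<bar>v0\<bar>"
  define M where "M = nat (\<lceil>(L + 2 * R') / \<eta>\<rceil> + 2)"
  have "card {w \<in> words n. wmap w ` E \<inter> {x..x + L * \<rho> ^ n} \<noteq> {}} \<le> M" (is "card ?S \<le> M") for n x
  proof -
    define q where "q = \<rho> ^ n"
    have q: "q > 0" using \<rho>_pos by (simp add: q_def)
    have wm: "wmap w x = q * x + offset w" if "w \<in> words n" for w x
      using that by (simp add: wmap_def length_words q_def)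
    \<comment> \<open>In units of \<open>\<eta> * q\<close> the images of \<open>v0\<close> under
      distinct words of one level are at least 1 apart: each is the centre of an interval of radius
      \<open>\<eta> * q\<close> inside its own copy of \<open>V\<close>. Hence their floors differ,
      and counting words becomes counting integers in a range.\<close>
    define c where "c w = wmap w v0 / (\<eta> * q)" for w
    have inj: "inj_on (\<lambda>w. \<lfloor>c w\<rfloor>) ?S"
    proof (rule inj_onI, rule ccontr)
      fix w w' assume w: "w \<in> ?S" "w' \<in> ?S" "\<lfloor>c w\<rfloor> = \<lfloor>c w'\<rfloor>" "w \<noteq> w'"
      then have "\<bar>c w - c w'\<bar> < 1" by linarith
      then have "\<bar>wmap w v0 - wmap w' v0\<bar> < \<eta> * q"
        using \<eta> q by (simp add: c_def diff_divide_distrib[symmetric] pos_divide_less_eq)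
      then have *: "\<bar>(wmap w' v0 - wmap w v0) / q\<bar> < \<eta>"
        using q by (simp add: pos_divide_less_eq abs_minus_commute)
      let ?z = "v0 + (wmap w' v0 - wmap w v0) / q"
      have "?z \<in> V" using * \<eta> by (auto simp: dist_real_def intro!: subsetD[OF \<eta>(2)])
      moreover have "wmap w ?z = wmap w' v0"
        using wm[of w] wm[of w'] w q by (simp add: field_simps)
      ultimately have "wmap w' v0 \<in> wmap w ` V \<inter> wmap w' ` V"
        using \<open>v0 \<in> V\<close> by (metis IntI imageI)
      then show False using dis[of w n w'] w by auto
    qed
    let ?l = "(x / q - R') / \<eta>" and ?u = "(x / q + L + R') / \<eta>"
    have rng: "(\<lambda>w. \<lfloor>c w\<rfloor>) ` ?S \<subseteq> {\<lfloor>?l\<rfloor>..\<lfloor>?u\<rfloor>}"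
    proof (rule image_subsetI)
      fix w assume "w \<in> ?S"
      then obtain e where w: "w \<in> words n" "e \<in> E" "x \<le> wmap w e" "wmap w e \<le> x + L * \<rho> ^ n"
        by auto
      have "wmap w v0 / q = wmap w e / q + (v0 - e)"
        using wm[of w] q w by (simp add: field_simps)
      moreover have "x / q \<le> wmap w e / q" "wmap w e / q \<le> x / q + L"
        using w q by (simp_all add: q_def[symmetric] field_simps)
      moreover have "\<bar>v0 - e\<bar> \<le> R'" using R(2)[OF w(2)] by (simp add: R'_def)
      ultimately have "x / q - R' \<le> wmap w v0 / q" "wmap w v0 / q \<le> x / q + L + R'"
        by linarith+
      moreover have "c w = (wmap w v0 / q) / \<eta>" by (simp add: c_def)
      ultimately have "?l \<le> c w" "c w \<le> ?u"
        using \<eta>(1) by (metis divide_right_mono less_imp_le)+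
      then show "\<lfloor>c w\<rfloor> \<in> {\<lfloor>?l\<rfloor>..\<lfloor>?u\<rfloor>}"
        unfolding atLeastAtMost_iff by (intro conjI floor_mono)
    qed
    have "card ?S = card ((\<lambda>w. \<lfloor>c w\<rfloor>) ` ?S)" using inj by (simp add: card_image)
    also have "\<dots> \<le> card {\<lfloor>?l\<rfloor>..\<lfloor>?u\<rfloor>}" using rng by (intro card_mono) auto
    also have "\<dots> \<le> M"
    proof -
      have "?u - ?l = (L + 2 * R') / \<eta>" using \<eta> by (simp add: field_simps)
      then have "\<lfloor>?u\<rfloor> + 1 - \<lfloor>?l\<rfloor> \<le> \<lceil>(L + 2 * R') / \<eta>\<rceil> + 2"
        by linarith
      then show ?thesis by (simp add: M_def)
    qed
    finally show ?thesis .
  qed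
  then show ?thesis using that by blast
qed

lemma powr_sim_dim: "\<rho> powr sim_dim = 1 / real m"
  using \<rho>_pos \<rho>_less m_ge
  by (simp add: powr_def sim_dim_def divide_simps exp_minus)

lemma sim_dim_pos: "sim_dim > 0"
  using \<rho>_pos \<rho>_less m_ge by (simp add: sim_dim_def divide_pos_neg)

section \<open>Hausdorff dimension and null sets\<close>

text \<open>A counting substitute for a mass distribution. In a finite cover by intervals of radii
  \<open>\<rho> ^ k i\<close>, each interval is met by at most \<open>M\<close> cylinders of level
  \<open>k i\<close>, hence accounts for at most \<open>M * m ^ (n - k i)\<close> words of length
  \<open>n\<close>. All \<open>m ^ n\<close> words must be accounted for, so the sum of
  \<open>(1 / m) ^ k i\<close> is at least \<open>1 / M\<close>. For \<open>s < sim_dim\<close> this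
  bounds the \<open>s\<close>-sums of covers away from 0.\<close>

lemma sim_dim_le_hausdorff_dim: "ereal sim_dim \<le> hausdorff_dim E"
  unfolding hausdorff_dim_def
proof (rule INF_greatest, clarsimp, rule ccontr)
  fix s assume s: "0 \<le> s" "hausdorff_measure s E = 0" "\<not> sim_dim \<le> s"
  obtain M where M: "\<And>n x. card {w \<in> words n. wmap w ` E \<inter> {x..x + 2 * \<rho> ^ n} \<noteq> {}} \<le> M"
    by (rule card_words_near_interval[of 2]) auto
  \<comment> \<open>The last estimate is \<open>M / \<rho> powr s * (2 * \<eta>)\<close>: the 2
    collects the cover and its error terms, and \<open>\<rho> powr s\<close> is lost in rounding
    diameters to powers of \<open>\<rho>\<close>. The \<open>1/2\<close> keeps \<open>\<eta>\<close>
    below 1, which excludes \<open>s = 0\<close>, where every non-empty set contributes 1.\<close>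
  define \<eta> where "\<eta> = min (1/2) (\<rho> powr s / (4 * (real M + 1)))"
  have \<eta>: "\<eta> > 0" "\<eta> < 1" "\<eta> * (4 * (real M + 1)) \<le> \<rho> powr s"
  proof -
    have "\<eta> \<le> \<rho> powr s / (4 * (real M + 1))" by (simp add: \<eta>_def)
    then show "\<eta> * (4 * (real M + 1)) \<le> \<rho> powr s" by (simp add: pos_le_divide_eq)
    have "\<rho> powr s / (4 * (real M + 1)) > 0" using \<rho>_pos by (intro divide_pos_pos) auto
    then show "\<eta> > 0" by (simp add: \<eta>_def)
    show "\<eta> < 1" by (simp add: \<eta>_def min_def)
  qed
  \<comment> \<open>Mesh \<open>1/2\<close> keeps all diameters below \<open>\<rho> ^ 0\<close>, so
    the least \<open>k\<close> with \<open>\<rho> ^ k\<close> at most the diameter has a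
    predecessor.\<close>
  have "hausdorff_premeasure s (1/2) E \<le> hausdorff_measure s E"
    unfolding hausdorff_measure_def by (rule SUP_upper) simp
  then have "hausdorff_premeasure s (1/2) E < ennreal \<eta>"
    using s \<eta> by simp
  then obtain U :: "nat \<Rightarrow> real set" where U: "E \<subseteq> (\<Union>i. U i)"
    "\<And>i. bounded (U i)" "\<And>i. diameter (U i) \<le> 1/2"
    and sumU: "(\<Sum>i. diam_pow s (U i)) < ennreal \<eta>"
    unfolding hausdorff_premeasure_def INF_less_iff by blast
  define dp where "dp i = (if U i = {} then 0 else if s = 0 then 1 else diameter (U i) powr s)" for i
  have dp: "diam_pow s (U i) = ennreal (dp i)" "dp i \<ge> 0" for i
    by (simp_all add: diam_pow_def dp_def)
  have fin: "(\<Sum>i. ennreal (dp i)) < ennreal \<eta>" using sumU dp by simp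
  then have summ: "summable dp"
    using dp(2) by (intro summable_suminf_not_top) (auto simp: top_unique)
  have dps: "(\<Sum>i. dp i) < \<eta>"
    using fin suminf_ennreal2[OF dp(2) summ] suminf_nonneg[OF summ dp(2)] by (simp add: ennreal_less_iff)
  have spos: "s > 0"
  proof (rule ccontr)
    assume "\<not> s > 0"
    then have "s = 0" using s by simp
    moreover obtain i where "U i \<noteq> {}" using U(1) E_nonempty by blast
    ultimately have "dp i = 1" by (simp add: dp_def)
    moreover have "dp i \<le> (\<Sum>i. dp i)"
      using sum_le_suminf[OF summ, of "{i}"] dp(2) by simp
    ultimately show False using dps \<eta> by simp
  qed
  have pw: "(\<rho> ^ n) powr s = (\<rho> powr s) ^ n" for n
    using \<rho>_pos by (induction n) (simp_all add: powr_mult)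
  \<comment> \<open>A single point has diameter 0 and no scale of its own; the summable error
    \<open>\<eta> * (1/2)^Suc i\<close> pays for an interval of positive radius around it.\<close>
  have ex: "\<exists>k. diameter (U i) < \<rho> ^ k \<and> (\<rho> ^ Suc k) powr s \<le> dp i + \<eta> * (1/2)^Suc i"
    if "U i \<noteq> {}" for i
  proof -
    let ?d = "diameter (U i)"
    have d0: "?d \<ge> 0" using U(2) by (rule diameter_ge_0)
    show ?thesis
    proof (cases "?d = 0")
      case True
      have "(\<lambda>k. (\<rho> powr s) ^ Suc k) \<longlonglongrightarrow> 0"
      proof -
        have "\<rho> powr s < 1" using spos \<rho>_pos \<rho>_less powr_less_mono'[of \<rho> 0 s] by simp
        then show ?thesis using LIMSEQ_Suc[OF LIMSEQ_power_zero[of "\<rho> powr s"]] by simp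
      qed
      moreover have "\<eta> * (1/2)^Suc i > 0" using \<eta> by simp
      ultimately have "\<forall>\<^sub>F k in sequentially. (\<rho> powr s) ^ Suc k < \<eta> * (1/2)^Suc i"
        by (simp only: order_tendstoD(2))
      then obtain k where "(\<rho> powr s) ^ Suc k < \<eta> * (1/2)^Suc i"
        by (auto simp: eventually_sequentially)
      moreover have "(\<rho> ^ Suc k) powr s = (\<rho> powr s) ^ Suc k"
        by (rule pw)
      ultimately show ?thesis
        using True \<rho>_pos dp(2)[of i] by (intro exI[of _ k]) auto
    next
      case False
      then have dpos: "?d > 0" using d0 by simp
      have "\<exists>k. \<rho> ^ k \<le> ?d"
        using real_arch_pow_inv[OF dpos \<rho>_less] by (auto intro: less_imp_le)
      define k where "k = (LEAST k. \<rho> ^ k \<le> ?d)"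
      have k: "\<rho> ^ k \<le> ?d" unfolding k_def by (rule LeastI_ex) fact
      have "k \<noteq> 0" using k U(3)[of i] by (intro notI) simp
      then obtain l where l: "k = Suc l" by (cases k) auto
      have "\<not> \<rho> ^ l \<le> ?d" using not_less_Least[of l "\<lambda>k. \<rho> ^ k \<le> ?d"] l by (simp add: k_def)
      moreover have "(\<rho> ^ Suc l) powr s \<le> ?d powr s"
        using k l spos \<rho>_pos by (intro powr_mono2) auto
      moreover have "dp i = ?d powr s" using that spos by (simp add: dp_def)
      moreover have "\<eta> * (1/2)^Suc i \<ge> 0" using \<eta> by simp
      ultimately show ?thesis by (intro exI[of _ l]) auto
    qed
  qed
  define k where "k i = (SOME k. diameter (U i) < \<rho> ^ k \<and> (\<rho> ^ Suc k) powr s \<le> dp i + \<eta> * (1/2)^Suc i)" for i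
  have k: "diameter (U i) < \<rho> ^ k i" "(\<rho> ^ Suc (k i)) powr s \<le> dp i + \<eta> * (1/2)^Suc i"
    if "U i \<noteq> {}" for i
    using someI_ex[OF ex[OF that]] unfolding k_def by blast+
  define p where "p i = (SOME x. x \<in> U i)" for i
  have p: "p i \<in> U i" if "U i \<noteq> {}" for i
    using that unfolding p_def by (simp add: some_in_eq)
  let ?O = "\<lambda>i. {p i - \<rho> ^ k i<..<p i + \<rho> ^ k i}"
  define J where "J = {i. U i \<noteq> {}}"
  have UO: "U i \<subseteq> ?O i" if "i \<in> J" for i
  proof
    fix x assume "x \<in> U i"
    then have "dist x (p i) \<le> diameter (U i)"
      using diameter_bounded_bound[OF U(2)] p that by (auto simp: J_def)
    then show "x \<in> ?O i" using k(1)[of i] that by (auto simp: J_def dist_real_def)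
  qed
  have "E \<subseteq> (\<Union>i\<in>J. ?O i)"
    using U(1) UO unfolding J_def by blast
  then obtain I where I: "I \<subseteq> J" "finite I" "E \<subseteq> (\<Union>i\<in>I. ?O i)"
    by (rule compactE_image[OF compact_E, of J ?O, rotated]) auto
  define n where "n = Max (k ` I)"
  have n: "k i \<le> n" if "i \<in> I" for i
    using I that by (auto simp: n_def)
  let ?N = "\<lambda>i. {w \<in> words (k i). wmap w ` E \<inter> {p i - \<rho> ^ k i..p i - \<rho> ^ k i + 2 * \<rho> ^ k i} \<noteq> {}}"
  \<comment> \<open>A word is charged to an interval containing one chosen point of its cylinder.
    Only the prefix of length \<open>k i\<close> is constrained by this; the other
    \<open>n - k i\<close> letters are free.\<close>
  have sub: "words n \<subseteq> (\<Union>i\<in>I. (\<lambda>(u, v). u @ v) ` (?N i \<times> words (n - k i)))"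
  proof
    fix w assume w: "w \<in> words n"
    obtain e where e: "e \<in> E" using E_nonempty by blast
    then have "wmap w e \<in> E" using w by (simp add: wmap_in_E)
    then obtain i where i: "i \<in> I" "wmap w e \<in> ?O i" using I by blast
    define u v where "u = take (k i) w" and "v = drop (k i) w"
    have uv: "u \<in> words (k i)" "v \<in> words (n - k i)" "w = u @ v"
      using w n[OF i(1)] set_take_subset[of "k i" w] set_drop_subset[of "k i" w]
      by (auto simp: u_def v_def words_def)
    have "wmap u (wmap v e) \<in> ?O i" using i uv by (simp add: wmap_append)
    moreover have "wmap v e \<in> E" using uv e wmap_in_E by blast
    ultimately have "u \<in> ?N i" using uv by auto
    then show "w \<in> (\<Union>i\<in>I. (\<lambda>(u, v). u @ v) ` (?N i \<times> words (n - k i)))"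
      using i uv by auto
  qed
  have "m ^ n \<le> card (\<Union>i\<in>I. (\<lambda>(u, v). u @ v) ` (?N i \<times> words (n - k i)))"
    unfolding card_words[symmetric] using I by (intro card_mono sub) auto
  also have "\<dots> \<le> (\<Sum>i\<in>I. card ((\<lambda>(u, v). u @ v) ` (?N i \<times> words (n - k i))))"
    by (rule card_UN_le) fact
  also have "\<dots> \<le> (\<Sum>i\<in>I. M * m ^ (n - k i))"
  proof (rule sum_mono)
    fix i
    have "card ((\<lambda>(u, v). u @ v) ` (?N i \<times> words (n - k i))) \<le> card (?N i \<times> words (n - k i))"
      by (rule card_image_le) auto
    also have "\<dots> \<le> M * m ^ (n - k i)"
      unfolding card_cartesian_product card_words by (intro mult_right_mono M) simp
    finally show "card ((\<lambda>(u, v). u @ v) ` (?N i \<times> words (n - k i))) \<le> M * m ^ (n - k i)" .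
  qed
  finally have "real (m ^ n) \<le> real (\<Sum>i\<in>I. M * m ^ (n - k i))"
    by (simp only: of_nat_le_iff)
  also have "\<dots> = real m ^ n * (real M * (\<Sum>i\<in>I. (1 / real m) ^ k i))"
  proof -
    have "real (M * m ^ (n - k i)) = real m ^ n * (real M * (1 / real m) ^ k i)" if "i \<in> I" for i
      using n[OF that] m_ge by (simp add: power_diff[where ?'a = real] power_one_over)
    then show ?thesis unfolding of_nat_sum sum_distrib_left by (intro sum.cong) auto
  qed
  finally have "1 \<le> real M * (\<Sum>i\<in>I. (1 / real m) ^ k i)"
    using m_ge by simp
  also have "\<dots> \<le> real M * (\<Sum>i\<in>I. (\<rho> ^ Suc (k i)) powr s / \<rho> powr s)"
  proof (intro mult_left_mono sum_mono)
    fix i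
    have "(1 / real m) ^ k i = (\<rho> powr sim_dim) ^ k i" by (simp add: powr_sim_dim)
    also have "\<dots> \<le> (\<rho> powr s) ^ k i"
      using s \<rho>_pos \<rho>_less by (intro power_mono powr_mono') auto
    also have "\<dots> = (\<rho> ^ Suc (k i)) powr s / \<rho> powr s"
      unfolding pw using \<rho>_pos by simp
    finally show "(1 / real m) ^ k i \<le> (\<rho> ^ Suc (k i)) powr s / \<rho> powr s" .
  qed simp
  also have "\<dots> = real M / \<rho> powr s * (\<Sum>i\<in>I. (\<rho> ^ Suc (k i)) powr s)"
    by (simp add: sum_divide_distrib[symmetric])
  also have "\<dots> \<le> real M / \<rho> powr s * (2 * \<eta>)"
  proof (rule mult_left_mono)
    have sm: "summable (\<lambda>i. \<eta> * (1/2::real)^Suc i)"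
      by (intro summable_mult) (simp add: summable_geometric)
    have "(\<Sum>i\<in>I. (\<rho> ^ Suc (k i)) powr s) \<le> (\<Sum>i\<in>I. dp i + \<eta> * (1/2)^Suc i)"
      using I(1) by (intro sum_mono k(2)) (auto simp: J_def)
    also have "\<dots> \<le> (\<Sum>i. dp i + \<eta> * (1/2)^Suc i)"
      using \<eta> dp I summ sm by (intro sum_le_suminf summable_add) auto
    also have "\<dots> = (\<Sum>i. dp i) + (\<Sum>i. \<eta> * (1/2)^Suc i)"
      using summ sm by (rule suminf_add[symmetric])
    also have "(\<Sum>i. \<eta> * (1/2::real)^Suc i) = \<eta>"
      using sums_mult[OF power_half_series, of \<eta>] by (simp add: sums_iff)
    finally show "(\<Sum>i\<in>I. (\<rho> ^ Suc (k i)) powr s) \<le> 2 * \<eta>" using dps by simp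
  qed simp
  also have "\<dots> < 1"
  proof -
    have "real M * (2 * \<eta>) = \<eta> * (2 * real M)" by simp
    also have "\<dots> < \<eta> * (4 * (real M + 1))" using \<eta>(1) by (intro mult_strict_left_mono) auto
    finally have "real M * (2 * \<eta>) < \<rho> powr s" using \<eta>(3) by linarith
    then show ?thesis using \<rho>_pos by (simp add: field_simps)
  qed
  finally show False by simp
qed

text \<open>Since \<open>sim_dim < 1\<close> means \<open>m * \<rho> < 1\<close>, the
  \<open>m ^ n\<close> intervals of length \<open>2 * R * \<rho> ^ n\<close> around the cylinders of
  level \<open>n\<close> have total length tending to 0.\<close>

lemma negligible_E:
  assumes "hausdorff_dim E < 1"
  shows "negligible E"
proof -
  have "ereal sim_dim < 1" using sim_dim_le_hausdorff_dim assms by (rule le_less_trans)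
  then have "sim_dim < 1" by simp
  then have "\<rho> powr 1 < \<rho> powr sim_dim"
    using \<rho>_pos \<rho>_less by (intro powr_less_mono') auto
  then have mr: "real m * \<rho> < 1"
    using \<rho>_pos m_ge by (simp add: powr_sim_dim field_simps)
  obtain R where R: "R > 0" "\<And>x. x \<in> E \<Longrightarrow> \<bar>x\<bar> \<le> R" by (rule E_bounded) auto
  show ?thesis
    unfolding negligible_outer_le
  proof (intro allI impI)
    fix e :: real assume "e > 0"
    have "(\<lambda>n. (real m * \<rho>) ^ n * (2 * R)) \<longlonglongrightarrow> 0 * (2 * R)"
      using mr \<rho>_pos by (intro tendsto_mult LIMSEQ_power_zero tendsto_const) simp
    then have "\<forall>\<^sub>F n in sequentially. (real m * \<rho>) ^ n * (2 * R) < e"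
      using \<open>e > 0\<close> by (intro order_tendstoD(2)) auto
    then obtain n where n: "(real m * \<rho>) ^ n * (2 * R) < e"
      by (auto simp: eventually_sequentially)
    let ?T = "\<Union>w\<in>words n. {offset w - \<rho> ^ n * R..offset w + \<rho> ^ n * R}"
    have "E \<subseteq> ?T"
    proof
      fix x assume "x \<in> E"
      then obtain w y where w: "w \<in> words n" "y \<in> E" "x = wmap w y" by (rule obtain_word)
      then have "\<bar>x - offset w\<bar> = \<rho> ^ n * \<bar>y\<bar>" using \<rho>_pos by (simp add: wmap_def length_words abs_mult)
      also have "\<dots> \<le> \<rho> ^ n * R" using R w \<rho>_pos by (intro mult_left_mono) auto
      finally show "x \<in> ?T" using w by (auto simp: abs_le_iff intro!: bexI[of _ w])
    qed
    moreover have "?T \<in> lmeasurable"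
      by (intro fmeasurable.finite_UN) auto
    moreover have "measure lebesgue ?T \<le> e"
    proof -
      have "measure lebesgue ?T \<le> (\<Sum>w\<in>words n. measure lebesgue {offset w - \<rho> ^ n * R..offset w + \<rho> ^ n * R})"
        by (rule measure_UNION_le) auto
      also have "\<dots> = (\<Sum>w\<in>words n. 2 * \<rho> ^ n * R)"
        using R \<rho>_pos by (intro sum.cong) auto
      also have "\<dots> = (real m * \<rho>) ^ n * (2 * R)"
        by (simp add: card_words power_mult_distrib)
      finally show ?thesis using n by simp
    qed
    ultimately show "\<exists>T. E \<subseteq> T \<and> T \<in> lmeasurable \<and> measure lebesgue T \<le> e" by blast
  qed
qed

section \<open>Upper Minkowski dimension of subsets\<close>

lemma covering_number_le:
  assumes "finite T" "A \<subseteq> (\<Union>t\<in>T. {t..t + \<delta>})"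
  shows "covering_number \<delta> A \<le> card T"
  unfolding covering_number_def by (rule Least_le) (use assms in blast)

text \<open>With \<open>K\<close> letters read at a time, every node has \<open>m ^ K\<close>
  children and at least one of them misses \<open>A\<close>, so the surviving tree branches at most
  \<open>m ^ K - 1\<close> times.\<close>

lemma card_words_meeting_le:
  assumes K: "\<And>u. u \<in> words (length u) \<Longrightarrow> \<exists>v\<in>words K. wmap (u @ v) ` E \<inter> A = {}"
  shows "card {w \<in> words (n * K). wmap w ` E \<inter> A \<noteq> {}} \<le> (m ^ K - 1) ^ n"
proof (induction n)
  case 0
  have "{w \<in> words (0 * K). wmap w ` E \<inter> A \<noteq> {}} \<subseteq> words 0" by auto
  then have "card {w \<in> words (0 * K). wmap w ` E \<inter> A \<noteq> {}} \<le> card (words 0)"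
    by (intro card_mono) auto
  then show ?case by simp
next
  case (Suc n)
  let ?S = "\<lambda>k. {w \<in> words k. wmap w ` E \<inter> A \<noteq> {}}"
  obtain v where v0: "\<And>u. u \<in> words (length u) \<Longrightarrow> v u \<in> words K \<and> wmap (u @ v u) ` E \<inter> A = {}"
    using K by metis
  then have v: "v u \<in> words K" "wmap (u @ v u) ` E \<inter> A = {}" if "u \<in> words k" for u k
    using that length_words[OF that] by auto
  have "?S (Suc n * K) \<subseteq> (\<lambda>(u, v). u @ v) ` (SIGMA u : ?S (n * K). words K - {v u})"
  proof
    fix w assume w: "w \<in> ?S (Suc n * K)"
    define x y where "x = take (n * K) w" and "y = drop (n * K) w"
    have xy: "x \<in> words (n * K)" "y \<in> words K" "w = x @ y"
      using w set_take_subset[of "n * K" w] set_drop_subset[of "n * K" w]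
      by (auto simp: x_def y_def words_def)
    obtain e where e: "e \<in> E" "wmap w e \<in> A" using w by auto
    have "wmap x (wmap y e) \<in> A" "wmap y e \<in> E" using e xy by (simp_all add: wmap_append wmap_in_E)
    then have "x \<in> ?S (n * K)" using xy by auto
    moreover have "y \<noteq> v x" using e xy v(2)[OF xy(1)] by auto
    ultimately show "w \<in> (\<lambda>(u, v). u @ v) ` (SIGMA u : ?S (n * K). words K - {v u})"
      using xy by auto
  qed
  then have "card (?S (Suc n * K)) \<le> card ((\<lambda>(u, v). u @ v) ` (SIGMA u : ?S (n * K). words K - {v u}))"
    by (intro card_mono) auto
  also have "\<dots> \<le> card (SIGMA u : ?S (n * K). words K - {v u})"
    by (rule card_image_le) auto
  also have "\<dots> = (\<Sum>u\<in>?S (n * K). card (words K - {v u}))"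
    by (simp add: card_SigmaI)
  also have "\<dots> = card (?S (n * K)) * (m ^ K - 1)"
  proof -
    have "card (words K - {v u}) = m ^ K - 1" if "u \<in> ?S (n * K)" for u
      using v(1)[of u "n * K"] that by (simp add: card_Diff_singleton card_words)
    then show ?thesis by simp
  qed
  also have "\<dots> \<le> (m ^ K - 1) ^ n * (m ^ K - 1)"
    by (intro mult_right_mono Suc) simp
  finally show ?case by (simp add: mult.commute)
qed

text \<open>Because one \<open>K\<close> serves all nodes, the loss is exponential: the dimension is
  at most \<open>ln (m ^ K - 1) / (K * - ln \<rho>)\<close>, which is less than
  \<open>ln m / - ln \<rho>\<close>.\<close>

lemma upper_minkowski_dim_less:
  assumes "A \<subseteq> E" and K: "\<And>u. u \<in> words (length u) \<Longrightarrow> \<exists>v\<in>words K. wmap (u @ v) ` E \<inter> A = {}"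
  shows "upper_minkowski_dim A < ereal sim_dim"
proof (cases "A = {}")
  case True
  then show ?thesis using sim_dim_pos by (simp add: upper_minkowski_dim_def)
next
  case False
  have "K \<noteq> 0" using K[of "[]"] False \<open>A \<subseteq> E\<close> by (intro notI) auto
  obtain R where R: "R > 0" "\<And>x. x \<in> E \<Longrightarrow> \<bar>x\<bar> \<le> R" by (rule E_bounded) auto
  define Q where "Q = real (m ^ K - 1)"
  have "m ^ K \<ge> 2 ^ K" using m_ge by (intro power_mono) auto
  moreover have "(2::nat) ^ K \<ge> 2" using \<open>K \<noteq> 0\<close> by (cases K) auto
  ultimately have mK: "m ^ K \<ge> 2" by linarith
  then have "1 \<le> m ^ K - 1" "m ^ K - 1 < m ^ K" by linarith+
  then have "real 1 \<le> real (m ^ K - 1)" "real (m ^ K - 1) < real (m ^ K)"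
    by (simp_all only: of_nat_le_iff of_nat_less_iff)
  then have Q: "Q \<ge> 1" "Q < real m ^ K" unfolding Q_def by simp_all
  define L where "L = - ln \<rho>"
  have L: "L > 0" using \<rho>_pos \<rho>_less by (simp add: L_def)
  \<comment> \<open>An upper bound for the number of blocks of \<open>K\<close> letters after which
    cylinders have diameter at most \<delta>, that is
    \<open>2 * R * \<rho> ^ (n * K) \<le> \<delta>\<close>; the 1 absorbs the ceiling.\<close>
  define h where "h \<delta> = (- ln \<delta> + ln (2 * R)) / (real K * L) + 1" for \<delta> :: real
  have bound: "ln (real (covering_number \<delta> A)) / - ln \<delta> \<le> h \<delta> * ln Q / - ln \<delta>"
    if \<delta>: "0 < \<delta>" "\<delta> < 1" "\<delta> < 2 * R" for \<delta>
  proof -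
    define n where "n = nat \<lceil>(- ln \<delta> + ln (2 * R)) / (real K * L)\<rceil>"
    have "ln \<delta> \<le> ln (2 * R)" using \<delta> R by simp
    then have "(- ln \<delta> + ln (2 * R)) / (real K * L) \<ge> 0" using L by simp
    then have n: "(- ln \<delta> + ln (2 * R)) / (real K * L) \<le> real n" "real n \<le> h \<delta>"
      unfolding n_def h_def by linarith+
    have "- ln \<delta> + ln (2 * R) \<le> real n * real K * L"
      using n(1) L \<open>K \<noteq> 0\<close> by (simp add: field_simps)
    then have "ln (2 * R) + real (n * K) * ln \<rho> \<le> ln \<delta>"
      by (simp add: L_def)
    then have "ln (2 * R * \<rho> ^ (n * K)) \<le> ln \<delta>"
      using \<rho>_pos R by (simp add: ln_mult ln_realpow)
    then have small: "2 * R * \<rho> ^ (n * K) \<le> \<delta>"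
      using \<delta> R \<rho>_pos by simp
    let ?S = "{w \<in> words (n * K). wmap w ` E \<inter> A \<noteq> {}}"
    let ?t = "\<lambda>w. offset w - R * \<rho> ^ (n * K)"
    have "A \<subseteq> (\<Union>t\<in>?t ` ?S. {t..t + \<delta>})"
    proof
      fix x assume x: "x \<in> A"
      then obtain w y where w: "w \<in> words (n * K)" "y \<in> E" "x = wmap w y"
        using \<open>A \<subseteq> E\<close> obtain_word by blast
      then have "\<bar>x - offset w\<bar> = \<rho> ^ (n * K) * \<bar>y\<bar>"
        using \<rho>_pos by (simp add: wmap_def length_words abs_mult)
      also have "\<dots> \<le> \<rho> ^ (n * K) * R" using R w \<rho>_pos by (intro mult_left_mono) auto
      finally have "?t w \<le> x" "x \<le> ?t w + \<delta>"
        using small by (simp_all add: abs_le_iff algebra_simps)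
      moreover have "w \<in> ?S" using w x by auto
      ultimately show "x \<in> (\<Union>t\<in>?t ` ?S. {t..t + \<delta>})" by auto
    qed
    then have "covering_number \<delta> A \<le> card (?t ` ?S)"
      by (intro covering_number_le) auto
    also have "\<dots> \<le> card ?S" by (rule card_image_le) simp
    also have "\<dots> \<le> (m ^ K - 1) ^ n" by (rule card_words_meeting_le) (rule K)
    finally have "real (covering_number \<delta> A) \<le> Q ^ n"
      unfolding Q_def by (simp only: of_nat_power[symmetric] of_nat_le_iff)
    \<comment> \<open>The logarithm is taken of a natural number; the value 0 is harmless because
      \<open>ln 0 = 0\<close> and \<open>Q ^ n \<ge> 1\<close>.\<close>
    then have "ln (real (covering_number \<delta> A)) \<le> ln (Q ^ n)"
      using Q by (cases "covering_number \<delta> A = 0") (auto intro!: ln_ge_zero)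
    also have "\<dots> = real n * ln Q" using Q by (simp add: ln_realpow)
    also have "\<dots> \<le> h \<delta> * ln Q" using n Q by (intro mult_right_mono) auto
    finally show ?thesis using \<delta> by (intro divide_right_mono) auto
  qed
  have lim: "((\<lambda>\<delta>. h \<delta> * ln Q / - ln \<delta>) \<longlongrightarrow> ln Q / (real K * L)) (at_right 0)"
  proof -
    have 1: "((\<lambda>\<delta>::real. 1 / ln \<delta>) \<longlongrightarrow> 0) (at_right 0)"
      by (intro tendsto_divide_0[OF tendsto_const] filterlim_at_bot_imp_at_infinity ln_at_0)
    have "((\<lambda>\<delta>. (1 / (real K * L) - (ln (2 * R) / (real K * L) + 1) * (1 / ln \<delta>)) * ln Q)
        \<longlongrightarrow> (1 / (real K * L) - (ln (2 * R) / (real K * L) + 1) * 0) * ln Q) (at_right 0)"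
      by (intro tendsto_intros 1)
    moreover have "\<forall>\<^sub>F \<delta> in at_right 0. (1 / (real K * L) - (ln (2 * R) / (real K * L) + 1) * (1 / ln \<delta>)) * ln Q
        = h \<delta> * ln Q / - ln \<delta>"
      unfolding eventually_at_right_field
    proof (intro exI[of _ 1] conjI allI impI)
      fix \<delta> :: real assume "0 < \<delta>" "\<delta> < 1"
      then have "ln \<delta> < 0" by simp
      then show "(1 / (real K * L) - (ln (2 * R) / (real K * L) + 1) * (1 / ln \<delta>)) * ln Q
        = h \<delta> * ln Q / - ln \<delta>"
        using L \<open>K \<noteq> 0\<close> by (simp add: h_def field_simps)
    qed simp
    ultimately show ?thesis by (simp add: tendsto_cong)
  qed
  have "upper_minkowski_dim A = Limsup (at_right 0) (\<lambda>\<delta>. ereal (ln (real (covering_number \<delta> A)) / - ln \<delta>))"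
    using False by (simp add: upper_minkowski_dim_def)
  also have "\<dots> \<le> Limsup (at_right 0) (\<lambda>\<delta>. ereal (h \<delta> * ln Q / - ln \<delta>))"
  proof (rule Limsup_mono)
    show "\<forall>\<^sub>F \<delta> in at_right 0. ereal (ln (real (covering_number \<delta> A)) / - ln \<delta>) \<le> ereal (h \<delta> * ln Q / - ln \<delta>)"
      unfolding eventually_at_right_field
      using bound R by (intro exI[of _ "min 1 (2 * R)"]) auto
  qed
  also have "\<dots> = ereal (ln Q / (real K * L))"
    using lim by (intro lim_imp_Limsup) auto
  also have "\<dots> < ereal sim_dim"
  proof -
    have "ln Q < ln (real m ^ K)" using Q by (intro ln_less_cancel_iff[THEN iffD2]) linarith+
    also have "\<dots> = real K * ln (real m)" using m_ge by (simp add: ln_realpow)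
    finally show ?thesis
      using L \<open>K \<noteq> 0\<close> by (simp add: sim_dim_def L_def[symmetric] field_simps)
  qed
  finally show ?thesis .
qed

end

section \<open>Affine maps close to the identity\<close>

text \<open>The orbit of \<open>x\<close> advances by at least \<delta> each time, so it passes
  \<open>z\<close>, and with a step of at most \<epsilon>. Iteration is avoided: a point of
  \<open>C\<close> within \<delta> of the supremum of \<open>C \<inter> {x..z}\<close> is already
  the last one before \<open>z\<close>.\<close>

lemma points_dense_if_moving_right:
  fixes C :: "real set"
  assumes "x \<in> C" "\<delta> > 0" "z \<in> {x..y}"
    and "\<And>w. w \<in> C \<inter> {x..y} \<Longrightarrow> g w \<in> C \<and> w + \<delta> \<le> g w \<and> g w \<le> w + \<epsilon>"
  shows "\<exists>w\<in>C. \<bar>w - z\<bar> \<le> \<epsilon>"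
proof -
  let ?S = "C \<inter> {x..z}"
  have S: "?S \<noteq> {}" "bdd_above ?S" using assms by auto
  obtain w where w: "w \<in> ?S" "Sup ?S - \<delta> < w"
    using less_cSup_iff[OF S, of "Sup ?S - \<delta>"] \<open>\<delta> > 0\<close> by auto
  then have g: "g w \<in> C" "w + \<delta> \<le> g w" "g w \<le> w + \<epsilon>"
    using assms(3) assms(4)[of w] by auto
  have "g w \<notin> ?S" using cSup_upper[OF _ S(2), of "g w"] g w by auto
  then have "g w > z" using g w \<open>\<delta> > 0\<close> by auto
  then show ?thesis using g w by (intro bexI[of _ w]) auto
qed

lemma points_dense_if_moving_left:
  fixes C :: "real set"
  assumes "y \<in> C" "\<delta> > 0" "z \<in> {x..y}"
    and "\<And>w. w \<in> C \<inter> {x..y} \<Longrightarrow> g w \<in> C \<and> w - \<epsilon> \<le> g w \<and> g w \<le> w - \<delta>"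
  shows "\<exists>w\<in>C. \<bar>w - z\<bar> \<le> \<epsilon>"
proof -
  have "\<exists>w\<in>uminus ` C. \<bar>w - - z\<bar> \<le> \<epsilon>"
    using assms
    by (intro points_dense_if_moving_right[of "- y" _ \<delta> "- z" "- x" "\<lambda>w. - g (- w)"]) force+
  then show ?thesis by (auto simp: abs_minus_commute)
qed

text \<open>The displacement \<open>(\<tau> - 1) * (w - p)\<close> is monotone in \<open>w\<close>
  and vanishes only at \<open>p\<close>. On an interval missing \<open>p\<close> it has one sign and
  is bounded away from 0. The sign decides whether the orbit starts at \<open>x\<close> or at
  \<open>y\<close>, so both have to lie in \<open>C\<close>.\<close>

lemma points_dense_away_from_fixed_point:
  fixes C :: "real set"
  assumes "x \<in> C" "y \<in> C" "x < y" "\<tau> \<noteq> 1" "p \<notin> {x..y}" "z \<in> {x..y}"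
    and in_C: "\<And>w. w \<in> C \<inter> {x..y} \<Longrightarrow> p + \<tau> * (w - p) \<in> C"
    and step: "\<And>w. w \<in> {x..y} \<Longrightarrow> \<bar>p + \<tau> * (w - p) - w\<bar> \<le> \<epsilon>"
  shows "\<exists>w\<in>C. \<bar>w - z\<bar> \<le> \<epsilon>"
proof -
  define D where "D w = (\<tau> - 1) * (w - p)" for w
  have D: "p + \<tau> * (w - p) = w + D w" for w by (simp add: D_def algebra_simps)
  have between: "min (D x) (D y) \<le> D w \<and> D w \<le> max (D x) (D y)" if "w \<in> {x..y}" for w
  proof (cases "\<tau> > 1")
    case True
    then have "D x \<le> D w" "D w \<le> D y"
      using that unfolding D_def by (auto intro!: mult_left_mono)
    then show ?thesis by auto
  next
    case False
    then have "D w \<le> D x" "D y \<le> D w"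
      using that unfolding D_def by (auto intro!: mult_left_mono_neg)
    then show ?thesis by auto
  qed
  have "(D x > 0 \<and> D y > 0) \<or> (D x < 0 \<and> D y < 0)"
    using assms(3-5) by (auto simp: D_def zero_less_mult_iff mult_less_0_iff)
  then show ?thesis
  proof
    assume pos: "D x > 0 \<and> D y > 0"
    show ?thesis
    proof (rule points_dense_if_moving_right[of x C "min (D x) (D y)" z y "\<lambda>w. w + D w"])
      fix w assume w: "w \<in> C \<inter> {x..y}"
      show "w + D w \<in> C \<and> w + min (D x) (D y) \<le> w + D w \<and> w + D w \<le> w + \<epsilon>"
        using in_C[OF w] step[of w] between[of w] w unfolding D by auto
    qed (use assms pos in auto)
  next
    assume neg: "D x < 0 \<and> D y < 0"
    show ?thesis
    proof (rule points_dense_if_moving_left[of y C "- max (D x) (D y)" z x "\<lambda>w. w + D w"])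
      fix w assume w: "w \<in> C \<inter> {x..y}"
      show "w + D w \<in> C \<and> w - \<epsilon> \<le> w + D w \<and> w + D w \<le> w - - max (D x) (D y)"
        using in_C[OF w] step[of w] between[of w] w unfolding D by auto
    qed (use assms neg in auto)
  qed
qed

text \<open>Slope different from 1 means a single fixed point, which moves with \<epsilon>. Four
  points of \<open>C\<close> span two disjoint intervals, and the fixed point misses at least one of
  them.\<close>

lemma closed_contains_interval_if_near_identity_invariant:
  fixes C :: "real set"
  assumes "closed C" and inf: "infinite (C \<inter> {l<..<u})"
    and near: "\<And>\<epsilon>. \<epsilon> > 0 \<Longrightarrow> \<exists>\<tau> c. \<tau> \<noteq> 1 \<and> (\<forall>z\<in>{l<..<u}. \<bar>\<tau> * z + c - z\<bar> \<le> \<epsilon>) \<and>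
                 (\<forall>z\<in>C \<inter> {l<..<u}. \<tau> * z + c \<in> C)"
  shows "\<exists>x y. x < y \<and> {x..y} \<subseteq> C \<inter> {l<..<u}"
proof -
  obtain T where T: "finite T" "card T = 4" "T \<subseteq> C \<inter> {l<..<u}"
    using infinite_arbitrarily_large[OF inf] by blast
  define xs where "xs = sorted_list_of_set T"
  have xs: "length xs = 4" "sorted_wrt (<) xs" "set xs \<subseteq> C \<inter> {l<..<u}"
    using T by (simp_all add: xs_def)
  obtain x1 x2 x3 x4 where "xs = [x1, x2, x3, x4]"
    using xs(1) by (auto simp: numeral_eq_Suc length_Suc_conv)
  then have x: "x1 < x2" "x2 < x3" "x3 < x4"
    and xC: "{x1, x2, x3, x4} \<subseteq> C" and xl: "l < x1" "x4 < u"
    using xs by auto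
  let ?dense = "\<lambda>\<epsilon> x y. \<forall>z\<in>{x..y}. \<exists>w\<in>C. \<bar>w - z\<bar> \<le> \<epsilon>"
  have either: "?dense \<epsilon> x1 x2 \<or> ?dense \<epsilon> x3 x4" if pos: "\<epsilon> > 0" for \<epsilon>
  proof -
    obtain \<tau> c where \<tau>: "\<tau> \<noteq> 1" "\<And>z. z \<in> {l<..<u} \<Longrightarrow> \<bar>\<tau> * z + c - z\<bar> \<le> \<epsilon>"
      "\<And>z. z \<in> C \<inter> {l<..<u} \<Longrightarrow> \<tau> * z + c \<in> C"
      using near[OF pos] by blast
    define p where "p = c / (1 - \<tau>)"
    have p: "\<tau> * z + c = p + \<tau> * (z - p)" for z
    proof -
      have "c = p * (1 - \<tau>)" using \<tau>(1) by (simp add: p_def)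
      then show ?thesis by (simp add: algebra_simps)
    qed
    have "p \<notin> {x1..x2} \<or> p \<notin> {x3..x4}" using x by auto
    then show ?thesis
    proof
      assume "p \<notin> {x1..x2}"
      then have "?dense \<epsilon> x1 x2"
        using x xC xl \<tau> unfolding p
        by (intro ballI points_dense_away_from_fixed_point[of x1 C x2 \<tau> p]) auto
      then show ?thesis ..
    next
      assume "p \<notin> {x3..x4}"
      then have "?dense \<epsilon> x3 x4"
        using x xC xl \<tau> unfolding p
        by (intro ballI points_dense_away_from_fixed_point[of x3 C x4 \<tau> p]) auto
      then show ?thesis ..
    qed
  qed
  \<comment> \<open>The interval that works may vary with \<epsilon>. Density at a scale implies
    density at every larger scale, so failures of both intervals would already collide at the
    smaller of the two scales.\<close>
  have "(\<forall>\<epsilon>>0. ?dense \<epsilon> x1 x2) \<or> (\<forall>\<epsilon>>0. ?dense \<epsilon> x3 x4)"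
  proof (rule ccontr)
    assume "\<not> ?thesis"
    then obtain \<epsilon>1 \<epsilon>2 where \<epsilon>: "\<epsilon>1 > 0" "\<epsilon>2 > 0" "\<not> ?dense \<epsilon>1 x1 x2" "\<not> ?dense \<epsilon>2 x3 x4"
      by blast
    have "?dense \<epsilon>1 x1 x2 \<or> ?dense \<epsilon>2 x3 x4"
      using either[of "min \<epsilon>1 \<epsilon>2"] \<epsilon>(1,2) by force
    then show False using \<epsilon> by blast
  qed
  moreover have "{x..y} \<subseteq> C" if dense: "\<forall>\<epsilon>>0. ?dense \<epsilon> x y" for x y
  proof
    fix z assume z: "z \<in> {x..y}"
    have "z \<in> closure C"
      unfolding closure_approachable dist_real_def
    proof (intro allI impI)
      fix e :: real assume "e > 0"
      then obtain w where "w \<in> C" "\<bar>w - z\<bar> \<le> e / 2"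
        using dense[rule_format, of "e / 2"] z by auto
      then show "\<exists>w\<in>C. \<bar>w - z\<bar> < e" using \<open>e > 0\<close> by (intro bexI[of _ w]) auto
    qed
    then show "z \<in> C" using \<open>closed C\<close> by simp
  qed
  ultimately have "{x1..x2} \<subseteq> C \<or> {x3..x4} \<subseteq> C" by blast
  moreover have "{x1..x2} \<subseteq> {l<..<u}" "{x3..x4} \<subseteq> {l<..<u}" using x xl by auto
  ultimately show ?thesis using x by blast
qed

section \<open>Limits of finite unions of affine copies\<close>

text \<open>Repetitions bring finite sets of varying size to the common index range
  \<open>{..<M}\<close>, so that sequences of them can converge coordinate by coordinate.\<close>

lemma finite_set_enum:
  assumes "finite S" "S \<noteq> {}" "card S \<le> M"
  shows "\<exists>h :: nat \<Rightarrow> 'a. h ` {..<M} = S"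
proof -
  obtain h where h: "bij_betw h {0..<card S} S"
    using ex_bij_betw_nat_finite[OF assms(1)] by blast
  have pos: "card S > 0" using assms by (simp add: card_gt_0_iff)
  let ?h = "\<lambda>j. if j < card S then h j else h 0"
  have "?h ` {..<M} = h ` {0..<card S}"
  proof
    show "?h ` {..<M} \<subseteq> h ` {0..<card S}" using pos by auto
    show "h ` {0..<card S} \<subseteq> ?h ` {..<M}"
    proof (rule image_subsetI)
      fix j assume "j \<in> {0..<card S}"
      then show "h j \<in> ?h ` {..<M}" using assms(3) by (intro image_eqI[of _ _ j]) auto
    qed
  qed
  then have "?h ` {..<M} = S" using h by (simp only: bij_betw_def)
  then show ?thesis by blast
qed

lemma bounded_tuples_convergent_subseq:
  fixes d :: "nat \<Rightarrow> nat \<Rightarrow> real"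
  assumes "\<And>i j. j < M \<Longrightarrow> \<bar>d i j\<bar> \<le> B"
  shows "\<exists>s D. strict_mono s \<and> (\<forall>j<M. (\<lambda>i. d (s i) j) \<longlonglongrightarrow> D j)"
  using assms
proof (induction M)
  case 0
  then show ?case by (auto intro!: exI[of _ id] simp: strict_mono_id)
next
  case (Suc M)
  then obtain s D where s: "strict_mono s" "\<And>j. j < M \<Longrightarrow> (\<lambda>i. d (s i) j) \<longlonglongrightarrow> D j"
    by force
  have "bounded (range (\<lambda>i. d (s i) M))"
    unfolding bounded_iff using Suc.prems[of M] by auto
  then obtain l s' where s': "strict_mono s'" "((\<lambda>i. d (s i) M) \<circ> s') \<longlonglongrightarrow> l"
    using bounded_imp_convergent_subsequence by blast
  have "(\<lambda>i. d ((s \<circ> s') i) j) \<longlonglongrightarrow> (D(M := l)) j" if "j < Suc M" for j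
  proof (cases "j = M")
    case True
    then show ?thesis using s'(2) by (simp add: o_def)
  next
    case False
    then have "j < M" using that by simp
    then show ?thesis
      using LIMSEQ_subseq_LIMSEQ[OF s(2) s'(1)] False by (simp add: o_def)
  qed
  then show ?case using strict_mono_o[OF s(1) s'(1)] by blast
qed

lemma limit_in_affine_union:
  fixes E :: "real set" and d :: "nat \<Rightarrow> nat \<Rightarrow> real"
  assumes "compact E" "\<tau> \<longlonglongrightarrow> t" "\<And>j. j < M \<Longrightarrow> (\<lambda>i. d i j) \<longlonglongrightarrow> D j" "z \<longlonglongrightarrow> Z"
    and ex: "\<And>i. \<exists>j<M. \<exists>e\<in>E. z i = \<tau> i * e + d i j"
  shows "\<exists>j<M. \<exists>e\<in>E. Z = t * e + D j"
proof -
  obtain j e where je: "\<And>i. j i < M" "\<And>i. e i \<in> E" "\<And>i. z i = \<tau> i * e i + d i (j i)"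
    using ex by metis
  \<comment> \<open>The index enters the compact product as a real number. One subsequence then
    makes the points of \<open>E\<close> converge and, integers being discrete, the index eventually
    constant.\<close>
  have cmp: "compact (E \<times> real ` {..<M})"
    by (intro compact_Times assms(1) finite_imp_compact) simp
  have in_prod: "\<forall>i. (e i, real (j i)) \<in> E \<times> real ` {..<M}" using je by simp
  obtain q s where q: "q \<in> E \<times> real ` {..<M}" "strict_mono s"
    "((\<lambda>i. (e i, real (j i))) \<circ> s) \<longlonglongrightarrow> q"
    using cmp[unfolded compact_def, THEN spec, THEN mp, OF in_prod] by blast
  then obtain e' j' where q_eq: "q = (e', real j')" "e' \<in> E" "j' < M" by auto
  have lim: "(\<lambda>i. e (s i)) \<longlonglongrightarrow> e'" "(\<lambda>i. real (j (s i))) \<longlonglongrightarrow> real j'"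
    using tendsto_fst[OF q(3)] tendsto_snd[OF q(3)] by (simp_all add: o_def q_eq)
  have "\<forall>\<^sub>F i in sequentially. dist (real (j (s i))) (real j') < 1"
    using lim(2) by (rule tendstoD) simp
  then have ev: "\<forall>\<^sub>F i in sequentially. j (s i) = j'"
    by eventually_elim (simp add: dist_real_def)
  have "(\<lambda>i. \<tau> (s i)) \<longlonglongrightarrow> t" "(\<lambda>i. d (s i) j') \<longlonglongrightarrow> D j'"
    using LIMSEQ_subseq_LIMSEQ[OF assms(2) q(2)]
      LIMSEQ_subseq_LIMSEQ[OF assms(3)[OF q_eq(3)] q(2)] by (simp_all add: o_def)
  then have "(\<lambda>i. \<tau> (s i) * e (s i) + d (s i) j') \<longlonglongrightarrow> t * e' + D j'"
    by (intro tendsto_intros lim(1))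
  moreover have "\<forall>\<^sub>F i in sequentially. \<tau> (s i) * e (s i) + d (s i) j' = z (s i)"
    using ev by eventually_elim (simp add: je)
  ultimately have "(\<lambda>i. z (s i)) \<longlonglongrightarrow> t * e' + D j'"
    by (rule Lim_transform_eventually)
  moreover have "(\<lambda>i. z (s i)) \<longlonglongrightarrow> Z"
    using LIMSEQ_subseq_LIMSEQ[OF assms(4) q(2)] by (simp add: o_def)
  ultimately have "Z = t * e' + D j'" using LIMSEQ_unique by blast
  then show ?thesis using q q_eq by auto
qed

section \<open>Baire argument for finite covers, and Diophantine approximation\<close>

text \<open>If \<open>C j\<close> does not contain all of \<open>X \<inter> U\<close>, then
  \<open>U - C j\<close> is an open set that still meets \<open>X\<close> and is served by the
  remaining sets.\<close>

lemma finite_closed_cover_localises: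
  assumes "finite J" "\<And>j. j \<in> J \<Longrightarrow> closed (C j)" "open U" "X \<inter> U \<noteq> {}" "X \<inter> U \<subseteq> (\<Union>j\<in>J. C j)"
  shows "\<exists>j\<in>J. \<exists>U'. open U' \<and> U' \<subseteq> U \<and> X \<inter> U' \<noteq> {} \<and> X \<inter> U' \<subseteq> C j"
  using assms
proof (induction J arbitrary: U rule: finite_induct)
  case (insert j J)
  show ?case
  proof (cases "X \<inter> U \<subseteq> C j")
    case True
    then show ?thesis using insert.prems by blast
  next
    case False
    then have "\<exists>i\<in>J. \<exists>U'. open U' \<and> U' \<subseteq> U - C j \<and> X \<inter> U' \<noteq> {} \<and> X \<inter> U' \<subseteq> C i"
      using insert.prems by (intro insert.IH) auto
    then show ?thesis by blast
  qed
qed auto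

text \<open>Dirichlet gives \<open>k\<close>, \<open>h\<close> with \<open>k * \<theta> - h\<close>
  of size below \<open>1 / Q\<close>, but no lower bound on \<open>k\<close>. Multiplying both by
  \<open>N'\<close> forces the exponent past \<open>N\<close> at the cost of a factor
  \<open>N'\<close> in the error, for which \<open>Q\<close> is chosen large enough. A ratio equal
  to 1 would make \<theta> rational.\<close>

lemma powers_ratio_near_1:
  fixes \<rho> r :: real
  assumes "0 < \<rho>" "\<rho> < 1" "0 < r" "r < 1" "ln r / ln \<rho> \<notin> \<rat>" "\<epsilon> > 0"
  shows "\<exists>n\<ge>N. \<exists>k. \<rho> ^ k / r ^ n \<noteq> 1 \<and> \<bar>\<rho> ^ k / r ^ n - 1\<bar> < \<epsilon>"
proof -
  define \<theta> where "\<theta> = ln r / ln \<rho>"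
  have lnn: "ln \<rho> < 0" "ln r < 0" using assms by simp_all
  then have \<theta>: "\<theta> > 0" "ln r = \<theta> * ln \<rho>" by (simp_all add: \<theta>_def divide_neg_neg)
  have "isCont exp (0::real)" by simp
  then obtain \<delta> where \<delta>: "\<delta> > 0" "\<And>x. \<bar>x\<bar> < \<delta> \<Longrightarrow> \<bar>exp x - 1\<bar> < \<epsilon>"
    using assms(6) unfolding continuous_at_eps_delta by (auto simp: dist_real_def)
  define N' where "N' = max 1 N"
  obtain Q :: nat where Q: "real Q > \<bar>ln \<rho>\<bar> * real N' / \<delta>" using reals_Archimedean2 by blast
  have "Q > 0" using Q \<delta> by (cases Q) (auto simp: divide_less_0_iff mult_less_0_iff not_less[symmetric])
  obtain h k where hk: "0 < k" "\<bar>of_int k * \<theta> - of_int h\<bar> < 1 / of_nat Q"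
    using Dirichlet_approx[OF \<open>Q > 0\<close>, of \<theta>] by blast
  \<comment> \<open>The exponent of \<rho> has to be a natural number.\<close>
  have "h \<ge> 0"
  proof (rule ccontr)
    assume "\<not> h \<ge> 0"
    then have "of_int h \<le> (-1::real)" by linarith
    moreover have "of_int k * \<theta> > 0" using hk \<theta> by simp
    moreover have "1 / real Q \<le> 1" using \<open>Q > 0\<close> by simp
    ultimately show False using hk by linarith
  qed
  define n l where "n = N' * nat k" and "l = N' * nat h"
  have n: "n \<ge> N" "n > 0" using hk(1) by (auto simp: n_def N'_def max_def intro: le_trans[OF _ mult_le_mono2[of 1]])
  define y where "y = real l * ln \<rho> - real n * ln r"
  have eq: "\<rho> ^ l / r ^ n = exp y"
    using assms by (simp add: y_def exp_diff exp_of_nat_mult)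
  have y: "y = - (real N' * ln \<rho> * (of_int k * \<theta> - of_int h))"
    using hk(1) \<open>h \<ge> 0\<close> by (simp add: y_def n_def l_def \<theta>(2) algebra_simps)
  have "\<bar>y\<bar> = real N' * \<bar>ln \<rho>\<bar> * \<bar>of_int k * \<theta> - of_int h\<bar>"
    by (simp add: y abs_mult)
  also have "\<dots> \<le> real N' * \<bar>ln \<rho>\<bar> * (1 / real Q)"
    using hk by (intro mult_left_mono) auto
  also have "\<dots> < \<delta>" using Q \<delta> \<open>Q > 0\<close> by (simp add: field_simps)
  finally have "\<bar>exp y - 1\<bar> < \<epsilon>" using \<delta> by blast
  moreover have "exp y \<noteq> 1"
  proof
    assume "exp y = 1"
    then have "real l * ln \<rho> = real n * ln r" by (simp add: y_def)
    then have "ln r / ln \<rho> = real l / real n" using n lnn by (simp add: field_simps)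
    then show False using assms(5) by simp
  qed
  ultimately show ?thesis using n eq by metis
qed

context homogeneous_ifs begin

section \<open>Small cylinders and infinitude of the attractor\<close>

text \<open>A point lies in at most \<open>M\<close> cylinders of a given level (the case of an
  interval of length 0), so a finite \<open>E\<close> could carry at most \<open>M * card E\<close>
  words of each length.\<close>

lemma infinite_E: "infinite E"
proof
  assume fin: "finite E"
  obtain M where M: "\<And>n x. card {w \<in> words n. wmap w ` E \<inter> {x..x + 0 * \<rho> ^ n} \<noteq> {}} \<le> M"
    by (rule card_words_near_interval[of 0]) auto
  define n where "n = M * card E"
  let ?S = "\<lambda>x. {w \<in> words n. wmap w ` E \<inter> {x..x + 0 * \<rho> ^ n} \<noteq> {}}"
  have "words n \<subseteq> (\<Union>x\<in>E. ?S x)"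
  proof
    fix w assume w: "w \<in> words n"
    obtain e where "e \<in> E" using E_nonempty by blast
    then have "w \<in> ?S (wmap w e)" "wmap w e \<in> E" using w wmap_in_E by auto
    then show "w \<in> (\<Union>x\<in>E. ?S x)" by blast
  qed
  then have "card (words n) \<le> card (\<Union>x\<in>E. ?S x)" using fin by (intro card_mono) auto
  also have "\<dots> \<le> (\<Sum>x\<in>E. card (?S x))" by (rule card_UN_le) (rule fin)
  also have "\<dots> \<le> (\<Sum>x\<in>E. M)" by (intro sum_mono M)
  also have "\<dots> = n" by (simp add: n_def mult.commute)
  finally have "m ^ n \<le> n" by (simp add: card_words)
  moreover have "n < 2 ^ n" by simp
  moreover have "(2::nat) ^ n \<le> m ^ n" using m_ge by (intro power_mono) auto
  ultimately show False by linarith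
qed

lemma small_cylinder:
  assumes "x \<in> E" "open U" "x \<in> U"
  obtains n w where "w \<in> words n" "x \<in> wmap w ` E" "wmap w ` E \<subseteq> U"
proof -
  obtain \<epsilon> where \<epsilon>: "\<epsilon> > 0" "ball x \<epsilon> \<subseteq> U" using assms open_contains_ball by blast
  obtain R where R: "R > 0" "\<And>x. x \<in> E \<Longrightarrow> \<bar>x\<bar> \<le> R" by (rule E_bounded) auto
  obtain n where n: "\<rho> ^ n < \<epsilon> / (2 * R)"
    using real_arch_pow_inv[of "\<epsilon> / (2 * R)" \<rho>] \<epsilon> R \<rho>_less by auto
  obtain w y where w: "w \<in> words n" "y \<in> E" "x = wmap w y" using assms(1) by (rule obtain_word)
  have "wmap w z \<in> U" if "z \<in> E" for z
  proof -
    have "x - wmap w z = \<rho> ^ n * (y - z)"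
      using w by (simp add: wmap_def length_words algebra_simps)
    then have "dist x (wmap w z) = \<rho> ^ n * \<bar>y - z\<bar>"
      using \<rho>_pos by (simp add: dist_real_def abs_mult)
    also have "\<dots> \<le> \<rho> ^ n * (2 * R)"
      using R(2)[OF that] R(2)[OF w(2)] \<rho>_pos by (intro mult_left_mono) auto
    also have "\<dots> < \<epsilon>" using n R by (simp add: field_simps)
    finally show ?thesis using \<epsilon> by auto
  qed
  then show ?thesis using that w by blast
qed

lemma infinite_E_Int_open:
  assumes "x \<in> E" "open U" "x \<in> U"
  shows "infinite (E \<inter> U)"
proof -
  obtain n w where w: "w \<in> words n" "wmap w ` E \<subseteq> U" by (rule small_cylinder[OF assms])
  have "inj_on (wmap w) E" using \<rho>_pos by (auto simp: inj_on_def wmap_def)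
  then have "infinite (wmap w ` E)" using infinite_E finite_imageD by blast
  moreover have "wmap w ` E \<subseteq> E \<inter> U" using w wmap_in_E by blast
  ultimately show ?thesis using finite_subset by blast
qed

section \<open>Affine embeddings\<close>

lemma no_contracting_affine_embedding:
  assumes "negligible E" "0 < r" "r < 1" "ln r / ln \<rho> \<notin> \<rat>"
    and emb: "\<And>x. x \<in> E \<Longrightarrow> r * x + c \<in> E"
  shows False
proof -
  obtain R0 where R0: "R0 > 0" "\<And>x. x \<in> E \<Longrightarrow> \<bar>x\<bar> \<le> R0" by (rule E_bounded) auto
  define R where "R = R0 + 1"
  have R: "R > 0" "\<And>x. x \<in> E \<Longrightarrow> \<bar>x\<bar> < R" using R0 by (force simp: R_def)+
  \<comment> \<open>The window \<open>{-R..R}\<close> seen at scale \<open>r ^ n\<close> has length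
    \<open>2 * R * r ^ n\<close>, which is at most \<open>4 * R * \<rho> ^ k\<close> as soon as
    \<open>\<rho> ^ k / r ^ n \<ge> 1/2\<close>.\<close>
  obtain M where M: "\<And>n x. card {w \<in> words n. wmap w ` E \<inter> {x..x + 4 * R * \<rho> ^ n} \<noteq> {}} \<le> M"
    by (rule card_words_near_interval[of "4 * R"]) auto
  \<comment> \<open>The translation part of the \<open>n\<close>-th iterate of
    \<open>\<lambda>x. r * x + c\<close>; thus \<open>U n\<close> is the preimage of
    \<open>E\<close> under that iterate.\<close>
  define cc where "cc n = ((\<lambda>x. r * x + c) ^^ n) 0" for n
  have cc: "cc 0 = 0" "cc (Suc n) = r * cc n + c" for n by (simp_all add: cc_def)
  define U where "U n = {z. r ^ n * z + cc n \<in> E}" for n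
  have U0: "U 0 = E" by (simp add: U_def cc)
  have "U n \<subseteq> U (Suc n)" for n
  proof
    fix z assume "z \<in> U n"
    then have "r * (r ^ n * z + cc n) + c \<in> E" unfolding U_def by (intro emb) auto
    then show "z \<in> U (Suc n)" by (simp add: U_def cc algebra_simps)
  qed
  then have Umono: "U n \<subseteq> U n'" if "n \<le> n'" for n n'
    using that by (rule lift_Suc_mono_le)
  have "\<forall>i. \<exists>n k. n \<ge> i \<and> \<rho> ^ k / r ^ n \<noteq> 1 \<and> \<bar>\<rho> ^ k / r ^ n - 1\<bar> < 1 / (real i + 2)"
    using powers_ratio_near_1[OF \<rho>_pos \<rho>_less assms(2-4)] by (simp add: add_nonneg_pos)
  then obtain n k where nk: "\<And>i. n i \<ge> i" "\<And>i. \<rho> ^ k i / r ^ n i \<noteq> 1"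
    "\<And>i. \<bar>\<rho> ^ k i / r ^ n i - 1\<bar> < 1 / (real i + 2)"
    by metis
  define \<tau> where "\<tau> i = \<rho> ^ k i / r ^ n i" for i :: nat
  have \<tau>1: "\<tau> i \<noteq> 1" "\<bar>\<tau> i - 1\<bar> < 1 / (real i + 2)" for i using nk by (auto simp: \<tau>_def)
  have \<tau>b: "1 / 2 \<le> \<tau> i" "\<tau> i \<le> 2" for i
  proof -
    have "1 / (real i + 2) \<le> 1 / 2" by (simp add: field_simps)
    then show "1 / 2 \<le> \<tau> i" "\<tau> i \<le> 2" using \<tau>1(2)[of i] by linarith+
  qed
  have \<tau>lim: "\<tau> \<longlonglongrightarrow> 1"
  proof -
    have "(\<lambda>i. 1 / (real i + 2)) \<longlonglongrightarrow> 0"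
      using LIMSEQ_ignore_initial_segment[OF lim_1_over_n, of 2] by (simp add: add.commute)
    then have "(\<lambda>i. \<tau> i - 1) \<longlonglongrightarrow> 0"
      by (rule Lim_null_comparison[rotated])
         (auto intro!: always_eventually less_imp_le[OF \<tau>1(2)])
    then show ?thesis by (simp add: LIM_zero_iff)
  qed
  define S where "S i = {w \<in> words (k i). wmap w ` E \<inter>
    {r ^ n i * (- R) + cc (n i)..r ^ n i * (- R) + cc (n i) + 4 * R * \<rho> ^ k i} \<noteq> {}}" for i
  \<comment> \<open>Pulling the cylinder of \<open>w\<close> back through the \<open>n i\<close>-th
    iterate gives the copy of \<open>E\<close> with slope \<open>\<tau> i\<close> and translation
    \<open>dd i w\<close>.\<close>
  define dd where "dd i w = (offset w - cc (n i)) / r ^ n i" for i w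
  have aff: "r ^ n i * (\<tau> i * e + dd i w) + cc (n i) = wmap w e" if "w \<in> words (k i)" for i w e
    using that \<open>0 < r\<close> by (simp add: \<tau>_def dd_def wmap_def length_words field_simps)
  have rn: "r ^ n i > 0" "r ^ n i * \<tau> i = \<rho> ^ k i" for i using \<open>0 < r\<close> by (simp_all add: \<tau>_def)
  have inU: "\<tau> i * e + dd i w \<in> U (n i)" if "w \<in> words (k i)" "e \<in> E" for i w e
    using aff[OF that(1)] wmap_in_E[OF that] by (simp add: U_def)
  have cover: "\<exists>w\<in>S i. \<exists>e\<in>E. z = \<tau> i * e + dd i w" if z: "z \<in> U (n i)" "\<bar>z\<bar> \<le> R" for i z
  proof -
    from z(1) have "r ^ n i * z + cc (n i) \<in> E" by (simp add: U_def)
    then obtain w e where w: "w \<in> words (k i)" "e \<in> E" "r ^ n i * z + cc (n i) = wmap w e"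
      by (rule obtain_word)
    then have "r ^ n i * z = r ^ n i * (\<tau> i * e + dd i w)" using aff[of w i e] by linarith
    then have "z = \<tau> i * e + dd i w" using rn(1)[of i] by (metis less_irrefl mult_left_cancel)
    moreover have "w \<in> S i"
    proof -
      have "r ^ n i * (- R) \<le> r ^ n i * z" using z(2) rn by (intro mult_left_mono) (auto intro: less_imp_le)
      moreover have "r ^ n i * z \<le> r ^ n i * (- R + 4 * R * \<tau> i)"
      proof (rule mult_left_mono)
        have "4 * R * (1 / 2) \<le> 4 * R * \<tau> i" using \<tau>b[of i] R by (intro mult_left_mono) auto
        then show "z \<le> - R + 4 * R * \<tau> i" using z(2) by linarith
      qed (use rn less_imp_le in auto)
      moreover have "r ^ n i * (- R + 4 * R * \<tau> i) = r ^ n i * (- R) + 4 * R * \<rho> ^ k i"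
        by (simp add: rn(2)[symmetric] algebra_simps)
      ultimately have "wmap w e \<in> {r ^ n i * (- R) + cc (n i)..r ^ n i * (- R) + cc (n i) + 4 * R * \<rho> ^ k i}"
        unfolding w(3)[symmetric] by simp
      then show ?thesis using w unfolding S_def by blast
    qed
    ultimately show ?thesis using w by blast
  qed
  \<comment> \<open>A crude bound uniform in \<open>i\<close>: some
    \<open>\<tau> i * e + dd i w\<close> lies between \<open>-R\<close> and \<open>7 * R\<close>,
    while \<open>\<tau> i * e\<close> has absolute value at most \<open>2 * R\<close>.\<close>
  have ddb: "\<bar>dd i w\<bar> \<le> 11 * R" if "w \<in> S i" for i w
  proof -
    from that obtain e where e: "w \<in> words (k i)" "e \<in> E"
      "r ^ n i * (- R) + cc (n i) \<le> wmap w e" "wmap w e \<le> r ^ n i * (- R) + cc (n i) + 4 * R * \<rho> ^ k i"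
      by (auto simp: S_def)
    have "r ^ n i * (- R) \<le> r ^ n i * (\<tau> i * e + dd i w)"
      using e(3) aff[OF e(1), of e] by linarith
    then have 1: "- R \<le> \<tau> i * e + dd i w" using rn mult_le_cancel_left_pos by blast
    have "r ^ n i * (\<tau> i * e + dd i w) \<le> r ^ n i * (- R + 4 * R * \<tau> i)"
      using e(4) aff[OF e(1), of e] by (simp add: rn(2)[symmetric] algebra_simps)
    then have 2: "\<tau> i * e + dd i w \<le> - R + 4 * R * \<tau> i" using rn mult_le_cancel_left_pos by blast
    have "\<bar>\<tau> i * e\<bar> \<le> 2 * R"
      unfolding abs_mult using \<tau>b[of i] R(2)[OF e(2)] by (intro mult_mono) auto
    moreover have "4 * R * \<tau> i \<le> 4 * R * 2" using \<tau>b[of i] R by (intro mult_left_mono) auto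
    ultimately show ?thesis using 1 2 R(1) by linarith
  qed
  have "\<exists>h::nat \<Rightarrow> real. h ` {..<M} = dd i ` S i" for i
  proof -
    have fin: "finite (S i)" by (simp add: S_def)
    obtain e where "e \<in> E" using E_nonempty by blast
    then have "e \<in> U (n i)" "\<bar>e\<bar> \<le> R" using Umono[of 0 "n i"] U0 R(2)[of e] by auto
    then have "S i \<noteq> {}" using cover by blast
    moreover have "card (S i) \<le> M" unfolding S_def by (rule M)
    then have "card (dd i ` S i) \<le> M" using card_image_le[OF fin, of "dd i"] by linarith
    ultimately show ?thesis using fin by (intro finite_set_enum) auto
  qed
  then obtain d :: "nat \<Rightarrow> nat \<Rightarrow> real" where d: "\<And>i. d i ` {..<M} = dd i ` S i" by metis
  have "\<bar>d i j\<bar> \<le> 11 * R" if "j < M" for i j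
  proof -
    have "d i j \<in> dd i ` S i" using d that by blast
    then show ?thesis using ddb by auto
  qed
  then obtain s D where s: "strict_mono s" and D: "\<And>j. j < M \<Longrightarrow> (\<lambda>i. d (s i) j) \<longlonglongrightarrow> D j"
    using bounded_tuples_convergent_subseq[of M d "11 * R"] by blast
  have \<tau>s: "(\<lambda>i. \<tau> (s i)) \<longlonglongrightarrow> 1" using LIMSEQ_subseq_LIMSEQ[OF \<tau>lim s] by (simp add: o_def)
  define V where "V = (\<Union>n. U n)"
  have copy: "\<tau> i * e + d i j \<in> V" if "j < M" "e \<in> E" for i j e
  proof -
    have "d i j \<in> dd i ` S i" using d that by blast
    then obtain w where "w \<in> words (k i)" "d i j = dd i w" by (auto simp: S_def)
    then show ?thesis using inU[of w i e] that by (auto simp: V_def)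
  qed
  define C where "C j = (\<lambda>e. D j + e) ` E" for j
  have C_closed: "closed (C j)" for j
    unfolding C_def by (intro closed_translation compact_imp_closed compact_E)
  \<comment> \<open>The sets \<open>U n\<close> increase, so a point of \<open>V\<close> lies in one
    of the copies for all large \<open>i\<close>; the shift by \<open>n0\<close> discards the
    earlier ones. Letting the slopes tend to 1 puts the point into a translate of
    \<open>E\<close>.\<close>
  have VC: "V \<inter> {-R<..<R} \<subseteq> (\<Union>j<M. C j)"
  proof
    fix z assume z: "z \<in> V \<inter> {-R<..<R}"
    then obtain n0 where n0: "z \<in> U n0" by (auto simp: V_def)
    have "\<exists>j<M. \<exists>e\<in>E. z = 1 * e + D j"
    proof (rule limit_in_affine_union[of E "\<lambda>i. \<tau> (s (i + n0))" 1 M "\<lambda>i. d (s (i + n0))" D "\<lambda>i. z"])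
      show "\<exists>j<M. \<exists>e\<in>E. z = \<tau> (s (i + n0)) * e + d (s (i + n0)) j" for i
      proof -
        let ?i = "s (i + n0)"
        have "n0 \<le> n ?i"
          using nk(1)[of ?i] strict_mono_imp_increasing[OF s, of "i + n0"] by linarith
        then have "z \<in> U (n ?i)" using n0 Umono by blast
        moreover have "\<bar>z\<bar> \<le> R" using z by (simp add: abs_le_iff)
        ultimately obtain w e where w: "w \<in> S ?i" "e \<in> E" "z = \<tau> ?i * e + dd ?i w"
          using cover[of z ?i] by blast
        then obtain j where "j < M" "d ?i j = dd ?i w" using d[of ?i] by (metis (no_types) imageE imageI lessThan_iff)
        then show ?thesis using w by metis
      qed
      show "(\<lambda>i. \<tau> (s (i + n0))) \<longlonglongrightarrow> 1" using \<tau>s by (rule LIMSEQ_ignore_initial_segment)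
      show "(\<lambda>i. d (s (i + n0)) j) \<longlonglongrightarrow> D j" if "j < M" for j
        using D[OF that] by (rule LIMSEQ_ignore_initial_segment)
    qed (use compact_E in auto)
    then show "z \<in> (\<Union>j<M. C j)" by (auto simp: C_def add.commute)
  qed
  have cl: "closure V \<inter> {-R<..<R} \<subseteq> (\<Union>j<M. C j)"
  proof -
    have "{-R<..<R} \<inter> closure V \<subseteq> closure ({-R<..<R} \<inter> V)" by (rule open_Int_closure_subset) simp
    also have "\<dots> \<subseteq> (\<Union>j<M. C j)"
      using VC C_closed by (intro closure_minimal closed_UN) auto
    finally show ?thesis by blast
  qed
  have "closure V \<inter> {-R<..<R} \<noteq> {}"
  proof -
    obtain e where "e \<in> E" using E_nonempty by blast
    then have "e \<in> V" "\<bar>e\<bar> < R" using U0 R(2)[of e] by (auto simp: V_def)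
    then have "e \<in> closure V \<inter> {-R<..<R}" using closure_subset[of V] by (auto simp: abs_less_iff)
    then show ?thesis by blast
  qed
  then obtain j U' where j: "j < M" and U': "open U'" "U' \<subseteq> {-R<..<R}" "closure V \<inter> U' \<noteq> {}"
    "closure V \<inter> U' \<subseteq> C j"
    using finite_closed_cover_localises[of "{..<M}" C "{-R<..<R}" "closure V"] C_closed cl by auto
  have "V \<inter> U' \<noteq> {}" using U'(1,3) open_Int_closure_eq_empty by blast
  then obtain z0 where z0: "z0 \<in> V" "z0 \<in> U'" by blast
  then obtain \<epsilon> where \<epsilon>: "\<epsilon> > 0" "ball z0 \<epsilon> \<subseteq> U'" using U'(1) open_contains_ball by blast
  define l u where "l = z0 - \<epsilon>" and "u = z0 + \<epsilon>"
  have lu: "{l<..<u} \<subseteq> U'" "z0 \<in> {l<..<u}"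
    using \<epsilon> by (auto simp: l_def u_def dist_real_def intro!: subsetD[OF \<epsilon>(2)])
  have "\<exists>x y. x < y \<and> {x..y} \<subseteq> closure V \<inter> {l<..<u}"
  proof (rule closed_contains_interval_if_near_identity_invariant)
    show "infinite (closure V \<inter> {l<..<u})"
    proof -
      obtain n0 where n0: "z0 \<in> U n0" using z0 by (auto simp: V_def)
      let ?h = "\<lambda>y. (y - cc n0) / r ^ n0"
      let ?O = "?h -` {l<..<u}"
      have "open ?O" using \<open>0 < r\<close> by (intro open_vimage) (auto intro!: continuous_intros)
      then have "infinite (E \<inter> ?O)"
        using n0 lu \<open>0 < r\<close> by (intro infinite_E_Int_open[of "r ^ n0 * z0 + cc n0"]) (auto simp: U_def)
      moreover have "inj_on ?h (E \<inter> ?O)" using \<open>0 < r\<close> by (auto simp: inj_on_def)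
      ultimately have "infinite (?h ` (E \<inter> ?O))" using finite_imageD by blast
      moreover have "?h ` (E \<inter> ?O) \<subseteq> closure V \<inter> {l<..<u}"
      proof
        fix y assume "y \<in> ?h ` (E \<inter> ?O)"
        then have "y \<in> U n0" "y \<in> {l<..<u}" using \<open>0 < r\<close> by (auto simp: U_def)
        then show "y \<in> closure V \<inter> {l<..<u}" using closure_subset[of V] by (auto simp: V_def)
      qed
      ultimately show ?thesis using finite_subset by blast
    qed
    fix \<epsilon> :: real assume "\<epsilon> > 0"
    \<comment> \<open>The near-identity map carries the limit copy \<open>C j\<close> onto the copy
      of \<open>E\<close> with slope \<open>\<tau> (s i)\<close> and translation
      \<open>d (s i) j\<close>, which lies in \<open>V\<close>. Since closure points in
      \<open>{l<..<u}\<close> belong to \<open>C j\<close>, they are mapped into \<open>V\<close>;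
      the displayed quantity bounds the displacement.\<close>
    have "(\<lambda>i. \<bar>\<tau> (s i) - 1\<bar> * R + \<bar>d (s i) j - \<tau> (s i) * D j\<bar>) \<longlonglongrightarrow> \<bar>1 - 1\<bar> * R + \<bar>D j - 1 * D j\<bar>"
      by (intro tendsto_intros \<tau>s D j)
    then have "\<forall>\<^sub>F i in sequentially. \<bar>\<tau> (s i) - 1\<bar> * R + \<bar>d (s i) j - \<tau> (s i) * D j\<bar> < \<epsilon>"
      using \<open>\<epsilon> > 0\<close> by (intro order_tendstoD(2)) auto
    then obtain i where i: "\<bar>\<tau> (s i) - 1\<bar> * R + \<bar>d (s i) j - \<tau> (s i) * D j\<bar> < \<epsilon>"
      by (auto simp: eventually_sequentially)
    let ?c = "d (s i) j - \<tau> (s i) * D j"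
    show "\<exists>\<tau> c. \<tau> \<noteq> 1 \<and> (\<forall>z\<in>{l<..<u}. \<bar>\<tau> * z + c - z\<bar> \<le> \<epsilon>) \<and>
                 (\<forall>z\<in>closure V \<inter> {l<..<u}. \<tau> * z + c \<in> closure V)"
    proof (rule exI[of _ "\<tau> (s i)"], rule exI[of _ ?c], intro conjI ballI)
      fix z assume z: "z \<in> {l<..<u}"
      then have "\<bar>z\<bar> \<le> R" using lu U' by force
      then have "\<bar>\<tau> (s i) - 1\<bar> * \<bar>z\<bar> \<le> \<bar>\<tau> (s i) - 1\<bar> * R" by (intro mult_left_mono) auto
      moreover have "\<bar>\<tau> (s i) * z + ?c - z\<bar> \<le> \<bar>\<tau> (s i) - 1\<bar> * \<bar>z\<bar> + \<bar>?c\<bar>"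
      proof -
        have "\<tau> (s i) * z + ?c - z = (\<tau> (s i) - 1) * z + ?c" by (simp add: algebra_simps)
        then show ?thesis by (metis abs_triangle_ineq abs_mult)
      qed
      ultimately show "\<bar>\<tau> (s i) * z + ?c - z\<bar> \<le> \<epsilon>" using i by linarith
    next
      fix z assume "z \<in> closure V \<inter> {l<..<u}"
      then have "z \<in> C j" using U' lu by blast
      then obtain e where e: "e \<in> E" "z = D j + e" by (auto simp: C_def)
      then have "\<tau> (s i) * z + ?c = \<tau> (s i) * e + d (s i) j" by (simp add: algebra_simps)
      then show "\<tau> (s i) * z + ?c \<in> closure V" 
        using subsetD[OF closure_subset copy[OF j e(1), of "s i"]] by (simp only:)
    qed (rule \<tau>1)
  qed simp
  then obtain x y where xy: "x < y" "{x..y} \<subseteq> closure V \<inter> {l<..<u}" by blast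
  then have "{x..y} \<subseteq> C j" using U' lu by blast
  moreover have "negligible (C j)" unfolding C_def by (rule negligible_translation) (rule assms(1))
  ultimately have "negligible {x..y}" using negligible_subset by blast
  then have "negligible (cbox x y)" by simp
  then have "box x y = {}" by (simp only: negligible_interval)
  then show False using xy(1) by simp
qed

text \<open>Squaring removes the sign. An embedding cannot enlarge the diameter of \<open>E\<close>,
  which is positive, so \<open>r\<^sup>2 \<le> 1\<close>; equality would give the rational value
  \<open>ln 1 / ln \<rho> = 0\<close>.\<close>

lemma no_affine_embedding:
  assumes "negligible E" "r \<noteq> 0" "ln \<bar>r\<bar> / ln \<rho> \<notin> \<rat>"
    and emb: "\<And>x. x \<in> E \<Longrightarrow> r * x + c \<in> E"
  shows False
proof -
  have emb2: "r\<^sup>2 * x + (r * c + c) \<in> E" if "x \<in> E" for x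
    using emb[OF emb[OF that]] by (simp add: algebra_simps power2_eq_square)
  have "r\<^sup>2 \<le> 1"
  proof -
    obtain x y where x: "x \<in> E" "\<And>z. z \<in> E \<Longrightarrow> z \<le> x" and y: "y \<in> E" "\<And>z. z \<in> E \<Longrightarrow> y \<le> z"
      using compact_attains_sup[OF compact_E E_nonempty] compact_attains_inf[OF compact_E E_nonempty] by blast
    have "x \<noteq> y"
    proof
      assume "x = y"
      then have "z = x" if "z \<in> E" for z using x(2)[OF that] y(2)[OF that] by simp
      then have "E \<subseteq> {x}" by blast
      then show False using infinite_E finite_subset by blast
    qed
    then have "x - y > 0" using x(2)[OF y(1)] by simp
    moreover have "r\<^sup>2 * (x - y) \<le> 1 * (x - y)"
      using x(2)[OF emb2[OF x(1)]] y(2)[OF emb2[OF y(1)]] unfolding right_diff_distrib by linarith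
    ultimately show ?thesis by (rule mult_right_le_imp_le[rotated])
  qed
  moreover have "r\<^sup>2 \<noteq> 1"
  proof
    assume "r\<^sup>2 = 1"
    then have "\<bar>r\<bar> = 1" by (auto simp: power2_eq_1_iff)
    then show False using assms(3) by simp
  qed
  moreover have "ln (r\<^sup>2) / ln \<rho> \<notin> \<rat>"
  proof
    have "ln (r\<^sup>2) = ln (\<bar>r\<bar> ^ 2)" by simp
    also have "\<dots> = 2 * ln \<bar>r\<bar>" using assms(2) by (subst ln_realpow) auto
    finally have "ln \<bar>r\<bar> / ln \<rho> = (ln (r\<^sup>2) / ln \<rho>) / 2" by simp
    moreover assume "ln (r\<^sup>2) / ln \<rho> \<in> \<rat>"
    ultimately show False using assms(3) by (metis Rats_divide Rats_number_of)
  qed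
  ultimately show False
    using no_contracting_affine_embedding[of "r\<^sup>2" "r * c + c"] assms(1,2) emb2 by fastforce
qed

end

section \<open>From intersections to embeddings\<close>

text \<open>Strict differentiability: the zoom compares two moving points near \<open>x\<close>,
  neither of which is \<open>x\<close>, so the derivative at \<open>x\<close> alone does not
  suffice. The mean value inequality is applied to \<open>f\<close> minus its linear part.\<close>

lemma C1_strict_derivative:
  fixes f :: "real \<Rightarrow> real"
  assumes "f C1_differentiable_on UNIV" "\<epsilon> > 0"
  obtains \<delta> where "\<delta> > 0"
    "\<And>y y'. \<bar>y - x\<bar> < \<delta> \<Longrightarrow> \<bar>y' - x\<bar> < \<delta> \<Longrightarrow> \<bar>f y - f y' - deriv f x * (y - y')\<bar> \<le> \<epsilon> * \<bar>y - y'\<bar>"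
proof -
  obtain D where D: "\<And>x. (f has_real_derivative D x) (at x)" "continuous_on UNIV D"
    using assms(1) unfolding C1_differentiable_on_def has_real_derivative_iff_has_vector_derivative by blast
  have Dx: "deriv f x = D x" using D(1) by (rule DERIV_imp_deriv)
  have "isCont D x" using D(2) by (simp add: continuous_on_eq_continuous_at)
  then obtain \<delta> where \<delta>: "\<delta> > 0" "\<And>y. dist y x < \<delta> \<Longrightarrow> dist (D y) (D x) < \<epsilon>"
    using assms(2) unfolding continuous_at_eps_delta by blast
  have "\<bar>f y - f y' - deriv f x * (y - y')\<bar> \<le> \<epsilon> * \<bar>y - y'\<bar>"
    if "\<bar>y - x\<bar> < \<delta>" "\<bar>y' - x\<bar> < \<delta>" for y y'
  proof -
    have "norm ((f y - D x * y) - (f y' - D x * y')) \<le> \<epsilon> * norm (y - y')"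
    proof (rule field_differentiable_bound[of "ball x \<delta>" _ "\<lambda>z. D z - D x"])
      fix z assume z: "z \<in> ball x \<delta>"
      have "((\<lambda>y. f y - D x * y) has_real_derivative D z - D x * 1) (at z)"
        by (rule DERIV_diff[OF D(1) DERIV_cmult[OF DERIV_ident]])
      then show "((\<lambda>y. f y - D x * y) has_real_derivative D z - D x) (at z within ball x \<delta>)"
        by (simp add: has_field_derivative_at_within)
      show "norm (D z - D x) \<le> \<epsilon>" using \<delta>(2)[of z] z by (simp add: dist_real_def abs_minus_commute)
    qed (use that in \<open>auto simp: dist_real_def abs_minus_commute\<close>)
    then show ?thesis by (simp add: Dx algebra_simps)
  qed
  then show ?thesis using \<delta> that by blast
qed

lemma C1_diffeomorphism_deriv_nonzero:
  assumes "C1_diffeomorphism f"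
  shows "deriv f x \<noteq> 0"
proof -
  let ?g = "inv f"
  have C: "bij f" "f C1_differentiable_on UNIV" "?g C1_differentiable_on UNIV"
    using assms by (auto simp: C1_diffeomorphism_def)
  obtain D where D: "\<And>x. (f has_real_derivative D x) (at x)"
    using C(2) unfolding C1_differentiable_on_def has_real_derivative_iff_has_vector_derivative by blast
  obtain D' where D': "\<And>x. (?g has_real_derivative D' x) (at x)"
    using C(3) unfolding C1_differentiable_on_def has_real_derivative_iff_has_vector_derivative by blast
  have "((\<lambda>x. ?g (f x)) has_real_derivative D' (f x) * D x) (at x)"
    by (rule DERIV_chain2[OF D' D])
  moreover have "?g (f x) = x" for x using C(1) by (simp add: bij_is_inj)
  ultimately have "((\<lambda>x. x) has_real_derivative D' (f x) * D x) (at x)" by simp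
  then have "D' (f x) * D x = 1" using DERIV_ident DERIV_unique by blast
  moreover have "deriv f x = D x" using D by (rule DERIV_imp_deriv)
  ultimately show ?thesis by auto
qed

context homogeneous_ifs begin

text \<open>Zooming in at the images of the full nodes \<open>u n\<close> straightens \<open>f\<close> to its derivative.\<close>

lemma full_nodes_imp_affine_cover:
  assumes "C1_diffeomorphism f"
    and u: "\<And>n. u n \<in> words (N n)" "\<And>n. n \<le> N n"
    and full: "\<And>n v. v \<in> words n \<Longrightarrow> wmap (u n @ v) ` E \<inter> (f ` E \<inter> E) \<noteq> {}"
  obtains x and M :: nat and D where "x \<in> E" "f x \<in> E" "E \<subseteq> (\<Union>j<M. (\<lambda>e. deriv f x * e + D j) ` E)"
proof -
  have C: "bij f" "f C1_differentiable_on UNIV" "inv f C1_differentiable_on UNIV"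
    using assms by (auto simp: C1_diffeomorphism_def)
  have contf: "isCont f x" for x
    using C1_diff_imp_diff[OF C(2)] differentiable_imp_continuous_on continuous_on_eq_continuous_at by blast
  have contg: "isCont (inv f) x" for x
    using C1_diff_imp_diff[OF C(3)] differentiable_imp_continuous_on continuous_on_eq_continuous_at by blast
  have inv: "inv f (f x) = x" for x using C(1) by (simp add: bij_is_inj)
  obtain R where R: "R > 0" "\<And>x. x \<in> E \<Longrightarrow> \<bar>x\<bar> \<le> R" by (rule E_bounded) auto
  define q where "q n = \<rho> ^ N n" for n
  have q: "q n > 0" "q n \<le> \<rho> ^ n" for n
    using \<rho>_pos \<rho>_less u(2)[of n] by (simp_all add: q_def power_decreasing)
  have wu: "wmap (u n) z = q n * z + offset (u n)" for n z
    by (simp add: wmap_def q_def length_words[OF u(1)])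
  have near: "\<exists>y\<in>E. f y \<in> E \<and> f y \<in> wmap (u n) ` E \<and> \<bar>f y - wmap (u n) z\<bar> \<le> q n * (\<rho> ^ n * (2 * R))"
    if z: "z \<in> E" for n z
  proof -
    obtain v z' where v: "v \<in> words n" "z' \<in> E" "z = wmap v z'" using z by (rule obtain_word)
    obtain p where p: "p \<in> wmap (u n @ v) ` E" "p \<in> f ` E" "p \<in> E" using full[OF v(1)] by blast
    then obtain e y where "e \<in> E" "y \<in> E" "p = wmap (u n @ v) e" "p = f y" by blast
    with p have y: "y \<in> E" "f y \<in> E" "e \<in> E" "f y = wmap (u n) (wmap v e)"
      by (auto simp: wmap_append)
    have "f y - wmap (u n) z = q n * (\<rho> ^ n * (e - z'))"
      unfolding y(4) v(3) wu by (simp add: wmap_def length_words[OF v(1)] algebra_simps)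
    then have "\<bar>f y - wmap (u n) z\<bar> = q n * (\<rho> ^ n * \<bar>e - z'\<bar>)"
      using q[of n] \<rho>_pos by (simp add: abs_mult)
    also have "\<dots> \<le> q n * (\<rho> ^ n * (2 * R))"
      using q[of n] \<rho>_pos R(2)[OF y(3)] R(2)[OF v(2)] by (intro mult_left_mono) auto
    finally show ?thesis using y wmap_in_E[OF v(1) y(3)] by blast
  qed
  have "\<exists>y\<in>E. f y \<in> E \<and> f y \<in> wmap (u n) ` E" for n
    using near E_nonempty by blast
  then obtain y0 where y0: "\<And>n. y0 n \<in> E" "\<And>n. f (y0 n) \<in> E" "\<And>n. f (y0 n) \<in> wmap (u n) ` E"
    by metis
  obtain x s where x: "x \<in> E" and s: "strict_mono s" "(y0 \<circ> s) \<longlonglongrightarrow> x"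
    using compact_E[unfolded compact_def, THEN spec, THEN mp, of y0] y0(1) by blast
  have fy0: "(\<lambda>i. f (y0 (s i))) \<longlonglongrightarrow> f x"
    using isCont_tendsto_compose[OF contf s(2)] by (simp add: o_def)
  have "f x \<in> E"
    using closed_sequentially[OF compact_imp_closed[OF compact_E], of "\<lambda>i. f (y0 (s i))"] y0(2) fy0 by blast
  define l where "l = deriv f x"
  have l: "l \<noteq> 0" using C1_diffeomorphism_deriv_nonzero[OF assms(1)] by (simp add: l_def)
  \<comment> \<open>Once \<open>f\<close> expands distances near \<open>x\<close> by at least
    \<open>\<bar>l\<bar> / 2\<close>, points of \<open>E\<close> sent into a node of diameter at
    most \<open>2 * R * q n\<close> are within \<open>4 * R * q n / \<bar>l\<bar>\<close>, half of
    \<open>L * q n\<close>, of each other.\<close>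
  define L where "L = 8 * R / \<bar>l\<bar>"
  have L: "L > 0" using R l by (simp add: L_def)
  obtain M where M: "\<And>n x. card {w \<in> words n. wmap w ` E \<inter> {x..x + L * \<rho> ^ n} \<noteq> {}} \<le> M"
    by (rule card_words_near_interval[of L]) auto
  define B where "B = R + \<bar>l\<bar> * (R + L / 2)"
  have qs: "(\<lambda>i. q (s i)) \<longlonglongrightarrow> 0"
  proof (rule tendsto_sandwich[of "\<lambda>_. 0" _ _ "\<lambda>i. \<rho> ^ s i"])
    have "(\<lambda>n. \<rho> ^ n) \<longlonglongrightarrow> 0" using \<rho>_pos \<rho>_less by (intro LIMSEQ_power_zero) auto
    from LIMSEQ_subseq_LIMSEQ[OF this s(1)] show "(\<lambda>i. \<rho> ^ s i) \<longlonglongrightarrow> 0" by (simp add: o_def)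
  qed (use q in \<open>auto intro!: always_eventually less_imp_le\<close>)
  \<comment> \<open>\<open>M\<close> and \<open>B\<close> do not depend on \<eta>, so compactness
    allows the approximate covers to converge to an exact one.\<close>
  have approx: "\<exists>h :: nat \<Rightarrow> real. (\<forall>j<M. \<bar>h j\<bar> \<le> B) \<and> (\<forall>z\<in>E. \<exists>j<M. \<exists>e\<in>E. \<bar>z - (l * e + h j)\<bar> \<le> \<eta>)"
    if \<eta>: "\<eta> > 0" for \<eta>
  proof -
    \<comment> \<open>The first bound gives the expansion of \<open>f\<close> by
      \<open>\<bar>l\<bar> / 2\<close>; the second keeps the linearisation error, rescaled by
      \<open>q n\<close>, at most \<open>\<eta> / 2\<close>. The other half of \<eta> is spent on
      the density of the points.\<close>
    define \<epsilon> where "\<epsilon> = min (\<bar>l\<bar> / 2) (\<eta> / L)"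
    have \<epsilon>: "\<epsilon> > 0" "\<epsilon> \<le> \<bar>l\<bar> / 2" "\<epsilon> * L \<le> \<eta>"
    proof -
      show "\<epsilon> > 0" using l \<eta> L by (simp add: \<epsilon>_def)
      show "\<epsilon> \<le> \<bar>l\<bar> / 2" unfolding \<epsilon>_def by (rule min.cobounded1)
      have "\<epsilon> \<le> \<eta> / L" unfolding \<epsilon>_def by (rule min.cobounded2)
      then show "\<epsilon> * L \<le> \<eta>" using L by (simp add: pos_le_divide_eq)
    qed
    obtain \<delta> where \<delta>: "\<delta> > 0"
      "\<And>y y'. \<bar>y - x\<bar> < \<delta> \<Longrightarrow> \<bar>y' - x\<bar> < \<delta> \<Longrightarrow> \<bar>f y - f y' - l * (y - y')\<bar> \<le> \<epsilon> * \<bar>y - y'\<bar>"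
      unfolding l_def by (rule C1_strict_derivative[OF C(2) \<epsilon>(1)]) auto
    \<comment> \<open>The node is small and close to \<open>f x\<close>; continuity of the inverse
      places all its preimages in the \<delta>-neighbourhood of \<open>x\<close>.\<close>
    obtain \<delta>' where \<delta>': "\<delta>' > 0" "\<And>w. dist w (f x) < \<delta>' \<Longrightarrow> dist (inv f w) x < \<delta>"
      using contg[of "f x"] \<delta>(1) unfolding continuous_at_eps_delta inv by blast
    have "\<forall>\<^sub>F i in sequentially. dist (f (y0 (s i))) (f x) < \<delta>' / 2"
      using fy0 \<delta>'(1) by (intro tendstoD) auto
    moreover have "\<forall>\<^sub>F i in sequentially. q (s i) * (2 * R) < \<delta>' / 2"
      using tendsto_mult_left_zero[OF qs, of "2 * R"] \<delta>'(1) by (intro order_tendstoD(2)) auto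
    moreover have "\<forall>\<^sub>F i in sequentially. \<rho> ^ s i * (2 * R) < \<eta> / 2"
    proof -
      have "(\<lambda>n. \<rho> ^ n) \<longlonglongrightarrow> 0" using \<rho>_pos \<rho>_less by (intro LIMSEQ_power_zero) auto
      from LIMSEQ_subseq_LIMSEQ[OF this s(1)] have "(\<lambda>i. \<rho> ^ s i) \<longlonglongrightarrow> 0" by (simp add: o_def)
      from tendsto_mult_left_zero[OF this, of "2 * R"] show ?thesis
        using \<eta> by (intro order_tendstoD(2)) auto
    qed
    ultimately have "\<forall>\<^sub>F i in sequentially. dist (f (y0 (s i))) (f x) < \<delta>' / 2 \<and>
        q (s i) * (2 * R) < \<delta>' / 2 \<and> \<rho> ^ s i * (2 * R) < \<eta> / 2"
      by (intro eventually_conj)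
    then obtain i where i: "dist (f (y0 (s i))) (f x) < \<delta>' / 2"
      "q (s i) * (2 * R) < \<delta>' / 2" "\<rho> ^ s i * (2 * R) < \<eta> / 2"
      unfolding eventually_sequentially by blast
    define n where "n = s i"
    define Y where "Y = {y \<in> E. f y \<in> wmap (u n) ` E}"
    have y0Y: "y0 n \<in> Y" using y0 by (simp add: Y_def)
    have fY: "\<bar>f y - f (y0 n)\<bar> \<le> q n * (2 * R)" if "y \<in> Y" for y
    proof -
      have "f y \<in> wmap (u n) ` E" "f (y0 n) \<in> wmap (u n) ` E"
        using that y0Y by (simp_all add: Y_def)
      then obtain e e' where e: "e \<in> E" "e' \<in> E" "f y = wmap (u n) e" "f (y0 n) = wmap (u n) e'"
        by blast
      then have "f y - f (y0 n) = q n * (e - e')" by (simp add: wu algebra_simps)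
      then have "\<bar>f y - f (y0 n)\<bar> = q n * \<bar>e - e'\<bar>" using q[of n] by (simp add: abs_mult)
      also have "\<dots> \<le> q n * (2 * R)"
        using q[of n] R(2)[OF e(1)] R(2)[OF e(2)] by (intro mult_left_mono) auto
      finally show ?thesis .
    qed
    have Yx: "\<bar>y - x\<bar> < \<delta>" if "y \<in> Y" for y
    proof -
      have "dist (f y) (f x) < \<delta>'"
        using fY[OF that] i(1,2) unfolding n_def dist_real_def by linarith
      from \<delta>'(2)[OF this] show ?thesis by (simp add: inv dist_real_def)
    qed
    have strict: "\<bar>f y - f (y0 n) - l * (y - y0 n)\<bar> \<le> \<epsilon> * \<bar>y - y0 n\<bar>" if "y \<in> Y" for y
      using \<delta>(2)[OF Yx[OF that] Yx[OF y0Y]] .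
    have Yd: "\<bar>y - y0 n\<bar> \<le> L / 2 * q n" if "y \<in> Y" for y
    proof -
      have "\<bar>l\<bar> * \<bar>y - y0 n\<bar> \<le> \<bar>f y - f (y0 n)\<bar> + \<epsilon> * \<bar>y - y0 n\<bar>"
        using strict[OF that] unfolding abs_mult[symmetric] by linarith
      also have "\<dots> \<le> q n * (2 * R) + \<bar>l\<bar> / 2 * \<bar>y - y0 n\<bar>"
        using fY[OF that] \<epsilon>(2) by (intro add_mono mult_right_mono) auto
      finally have "\<bar>l\<bar> * \<bar>y - y0 n\<bar> \<le> 4 * R * q n" by (simp add: field_simps)
      then show ?thesis using l by (simp add: L_def field_simps)
    qed
    define S where "S = {w \<in> words (N n). wmap w ` E \<inter> {y0 n - L / 2 * q n..y0 n - L / 2 * q n + L * \<rho> ^ N n} \<noteq> {}}"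
    \<comment> \<open>Linearise \<open>f\<close> at \<open>y0 n\<close> on the cylinder of
      \<open>w\<close> and undo \<open>wmap (u n)\<close>: the result is \<open>e\<close> mapped to
      \<open>l * e + dd w\<close>. The slope is exactly \<open>l\<close> because \<open>w\<close>
      and \<open>u n\<close> have equal length.\<close>
    define dd where "dd w = (f (y0 n) - offset (u n)) / q n + l * ((offset w - y0 n) / q n)" for w
    have ww: "wmap w e = q n * e + offset w" if "w \<in> words (N n)" for w e
      using that by (simp add: wmap_def length_words q_def)
    have bound: "\<bar>dd w\<bar> \<le> B" if w: "w \<in> S" for w
    proof -
      obtain e' where e': "e' \<in> E" "f (y0 n) = wmap (u n) e'" using y0 by blast
      then have 1: "(f (y0 n) - offset (u n)) / q n = e'" using q[of n] by (simp add: wu)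
      obtain e where e: "w \<in> words (N n)" "e \<in> E"
        "y0 n - L / 2 * q n \<le> wmap w e" "wmap w e \<le> y0 n - L / 2 * q n + L * q n"
        using w by (auto simp: S_def q_def)
      then have "\<bar>offset w - y0 n + q n * e\<bar> \<le> q n * (L / 2)"
        unfolding ww[OF e(1)] by (intro abs_leI) (simp_all add: field_simps)
      moreover have "offset w - y0 n + q n * e = q n * ((offset w - y0 n) / q n + e)"
        using q[of n] by (simp add: field_simps)
      ultimately have "\<bar>(offset w - y0 n) / q n + e\<bar> \<le> L / 2"
        using q(1)[of n] by (simp add: abs_mult)
      then have "\<bar>(offset w - y0 n) / q n\<bar> \<le> R + L / 2" using R(2)[OF e(2)] by linarith
      then have "\<bar>l * ((offset w - y0 n) / q n)\<bar> \<le> \<bar>l\<bar> * (R + L / 2)"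
        unfolding abs_mult by (intro mult_left_mono) auto
      then show ?thesis using R(2)[OF e'(1)] unfolding dd_def B_def 1 by linarith
    qed
    have cover: "\<exists>w\<in>S. \<exists>e\<in>E. \<bar>z - (l * e + dd w)\<bar> \<le> \<eta>" if z: "z \<in> E" for z
    proof -
      obtain y where y: "y \<in> Y" "\<bar>f y - wmap (u n) z\<bar> \<le> q n * (\<rho> ^ n * (2 * R))"
        using near[OF z, of n] by (auto simp: Y_def)
      obtain w e where w: "w \<in> words (N n)" "e \<in> E" "y = wmap w e"
        using y(1) obtain_word[of y "N n"] by (auto simp: Y_def)
      have "wmap w e \<in> {y0 n - L / 2 * q n..y0 n - L / 2 * q n + L * \<rho> ^ N n}"
        using Yd[OF y(1)] unfolding w(3) abs_le_iff q_def by simp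
      then have "w \<in> S" using w by (auto simp: S_def)
      have "q n * (z - (l * e + dd w)) = (wmap (u n) z - f y) + (f y - f (y0 n) - l * (y - y0 n))"
        unfolding wu w(3) ww[OF w(1)] dd_def using q(1)[of n] by (simp add: field_simps)
      then have "\<bar>q n * (z - (l * e + dd w))\<bar> \<le> \<bar>wmap (u n) z - f y\<bar> + \<bar>f y - f (y0 n) - l * (y - y0 n)\<bar>"
        by linarith
      also have "\<dots> \<le> q n * (\<rho> ^ n * (2 * R)) + \<epsilon> * (L / 2 * q n)"
      proof (intro add_mono)
        show "\<bar>wmap (u n) z - f y\<bar> \<le> q n * (\<rho> ^ n * (2 * R))" using y(2) by (simp add: abs_minus_commute)
        have "\<epsilon> * \<bar>y - y0 n\<bar> \<le> \<epsilon> * (L / 2 * q n)"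
          using Yd[OF y(1)] \<epsilon>(1) by (intro mult_left_mono) auto
        then show "\<bar>f y - f (y0 n) - l * (y - y0 n)\<bar> \<le> \<epsilon> * (L / 2 * q n)"
          using strict[OF y(1)] by linarith
      qed
      also have "\<dots> = q n * (\<rho> ^ n * (2 * R) + \<epsilon> * L / 2)" by (simp add: algebra_simps)
      also have "\<dots> \<le> q n * \<eta>"
        using i(3) \<epsilon>(3) q(1)[of n] unfolding n_def[symmetric] by (intro mult_left_mono) auto
      finally have "\<bar>z - (l * e + dd w)\<bar> \<le> \<eta>" using q(1)[of n] by (simp add: abs_mult)
      then show ?thesis using \<open>w \<in> S\<close> w by blast
    qed
    have fin: "finite S" by (simp add: S_def)
    have "card S \<le> M" unfolding S_def by (rule M)
    then have "card (dd ` S) \<le> M" using card_image_le[OF fin, of dd] by linarith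
    moreover have "S \<noteq> {}" using cover E_nonempty by blast
    ultimately have "\<exists>h :: nat \<Rightarrow> real. h ` {..<M} = dd ` S"
      using fin by (intro finite_set_enum) auto
    then obtain h :: "nat \<Rightarrow> real" where h: "h ` {..<M} = dd ` S" ..
    have "\<bar>h j\<bar> \<le> B" if "j < M" for j
    proof -
      have "h j \<in> dd ` S" using h that by blast
      then show ?thesis using bound by auto
    qed
    moreover have "\<exists>j<M. \<exists>e\<in>E. \<bar>z - (l * e + h j)\<bar> \<le> \<eta>" if z: "z \<in> E" for z
    proof -
      obtain w e where w: "w \<in> S" "e \<in> E" "\<bar>z - (l * e + dd w)\<bar> \<le> \<eta>" using cover[OF z] by blast
      have "dd w \<in> h ` {..<M}" using h w by blast
      then obtain j where "j < M" "h j = dd w" by auto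
      then show ?thesis using w by metis
    qed
    ultimately show ?thesis by blast
  qed
  have "\<exists>h :: nat \<Rightarrow> real. (\<forall>j<M. \<bar>h j\<bar> \<le> B) \<and>
      (\<forall>z\<in>E. \<exists>j<M. \<exists>e\<in>E. \<bar>z - (l * e + h j)\<bar> \<le> 1 / real (Suc i))" for i
    by (rule approx) simp
  then obtain h :: "nat \<Rightarrow> nat \<Rightarrow> real" where
    hh: "\<And>i. (\<forall>j<M. \<bar>h i j\<bar> \<le> B) \<and>
      (\<forall>z\<in>E. \<exists>j<M. \<exists>e\<in>E. \<bar>z - (l * e + h i j)\<bar> \<le> 1 / real (Suc i))"
    by metis
  have h: "\<And>i j. j < M \<Longrightarrow> \<bar>h i j\<bar> \<le> B"
    "\<And>i z. z \<in> E \<Longrightarrow> \<exists>j<M. \<exists>e\<in>E. \<bar>z - (l * e + h i j)\<bar> \<le> 1 / real (Suc i)"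
    using hh by simp_all
  obtain s' D where s': "strict_mono s'" and D: "\<And>j. j < M \<Longrightarrow> (\<lambda>i. h (s' i) j) \<longlonglongrightarrow> D j"
    using bounded_tuples_convergent_subseq[of M h B] h(1) by blast
  have "E \<subseteq> (\<Union>j<M. (\<lambda>e. l * e + D j) ` E)"
  proof
    fix z assume z: "z \<in> E"
    have "\<forall>i. \<exists>y. (\<exists>j<M. \<exists>e\<in>E. y = l * e + h (s' i) j) \<and> \<bar>z - y\<bar> \<le> 1 / real (Suc (s' i))"
      using h(2)[OF z] by metis
    then obtain y where y: "\<And>i. \<exists>j<M. \<exists>e\<in>E. y i = l * e + h (s' i) j"
      "\<And>i. \<bar>z - y i\<bar> \<le> 1 / real (Suc (s' i))" by metis
    have "(\<lambda>i. y i - z) \<longlonglongrightarrow> 0"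
    proof (rule Lim_null_comparison)
      show "\<forall>\<^sub>F i in sequentially. norm (y i - z) \<le> 1 / real (Suc (s' i))"
        using y(2) by (simp add: abs_minus_commute)
      show "(\<lambda>i. 1 / real (Suc (s' i))) \<longlonglongrightarrow> 0"
        using LIMSEQ_subseq_LIMSEQ[OF LIMSEQ_Suc[OF lim_1_over_n] s'] by (simp add: o_def)
    qed
    then have "y \<longlonglongrightarrow> z" by (simp add: LIM_zero_iff)
    from limit_in_affine_union[OF compact_E tendsto_const D this y(1)]
    show "z \<in> (\<Union>j<M. (\<lambda>e. l * e + D j) ` E)" by blast
  qed
  from that[OF x \<open>f x \<in> E\<close> this[unfolded l_def]] show ?thesis .
qed

text \<open>Undoing the copy on a cylinder that it contains gives an affine map of \<open>E\<close>
  into \<open>E\<close> with slope \<open>\<rho> ^ n / l\<close>. Its logarithm to base \<rho> is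
  \<open>n\<close> minus that of \<open>l\<close>, up to signs of the slopes, so both are irrational
  together.\<close>

lemma affine_cover_imp_rational:
  assumes "negligible E" "l \<noteq> 0" "E \<subseteq> (\<Union>j<M::nat. (\<lambda>e. l * e + D j) ` E)"
  shows "ln \<bar>l\<bar> / ln \<rho> \<in> \<rat>"
proof (rule ccontr)
  assume irr: "ln \<bar>l\<bar> / ln \<rho> \<notin> \<rat>"
  have "\<exists>j\<in>{..<M}. \<exists>U. open U \<and> U \<subseteq> UNIV \<and> E \<inter> U \<noteq> {} \<and> E \<inter> U \<subseteq> (\<lambda>e. l * e + D j) ` E"
  proof (rule finite_closed_cover_localises)
    fix j
    have "compact ((\<lambda>e. l * e + D j) ` E)"
      by (intro compact_continuous_image compact_E continuous_intros)
    then show "closed ((\<lambda>e. l * e + D j) ` E)" by (rule compact_imp_closed)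
  qed (use assms E_nonempty in auto)
  then obtain j U x where U: "open U" "x \<in> E" "x \<in> U" "E \<inter> U \<subseteq> (\<lambda>e. l * e + D j) ` E" by blast
  obtain n w where w: "w \<in> words n" "wmap w ` E \<subseteq> U" using U(2,1,3) by (rule small_cylinder)
  have "\<rho> ^ n / l * x + (offset w - D j) / l \<in> E" if "x \<in> E" for x
  proof -
    have "wmap w x \<in> E \<inter> U" using w wmap_in_E that by blast
    then obtain e where e: "e \<in> E" "wmap w x = l * e + D j" using U(4) by blast
    then have "\<rho> ^ n / l * x + (offset w - D j) / l = e"
      using assms(2) w(1) by (simp add: wmap_def length_words field_simps)
    then show ?thesis using e by simp
  qed
  moreover have "ln \<bar>\<rho> ^ n / l\<bar> / ln \<rho> \<notin> \<rat>"
  proof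
    have "ln \<bar>\<rho> ^ n / l\<bar> = real n * ln \<rho> - ln \<bar>l\<bar>"
      using \<rho>_pos assms(2) by (simp add: abs_divide ln_div ln_realpow)
    moreover have "ln \<rho> \<noteq> 0" using \<rho>_pos \<rho>_less by simp
    ultimately have "ln \<bar>l\<bar> / ln \<rho> = real n - ln \<bar>\<rho> ^ n / l\<bar> / ln \<rho>" by (simp add: field_simps)
    moreover assume "ln \<bar>\<rho> ^ n / l\<bar> / ln \<rho> \<in> \<rat>"
    ultimately show False using irr by simp
  qed
  ultimately show False
    using no_affine_embedding[of "\<rho> ^ n / l" "(offset w - D j) / l"] assms(1,2) \<rho>_pos by auto
qed

end

section \<open>Holes of uniform depth versus arbitrarily full nodes\<close>

theorem theorem1p1:
  fixes m :: nat and \<rho> :: real and a :: "nat \<Rightarrow> real"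
    and E :: "real set" and f :: "real \<Rightarrow> real"
  assumes "m \<ge> 2"
    and "0 < \<rho>" and "\<rho> < 1"
    and "self_similar_set {1..m} (\<lambda>i x. \<rho> * x + a i) E"
    and "open_set_condition {1..m} (\<lambda>i x. \<rho> * x + a i)"
    and "hausdorff_dim E < 1"
    and "C1_diffeomorphism f"
    and "\<And>x. x \<in> E \<inter> f -` E \<Longrightarrow> ln \<bar>deriv f x\<bar> / ln \<rho> \<notin> \<rat>"
  shows "upper_minkowski_dim (f ` E \<inter> E) < hausdorff_dim E"
proof -
  interpret homogeneous_ifs m \<rho> a E
    using assms(1-5) by unfold_locales
  have negl: "negligible E" using assms(6) by (rule negligible_E)
  define hole where "hole K u \<longleftrightarrow> (\<exists>v\<in>words K. wmap (u @ v) ` E \<inter> (f ` E \<inter> E) = {})" for K u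
  have "\<exists>K. \<forall>u. u \<in> words (length u) \<longrightarrow> hole K u"
  proof (rule ccontr)
    assume "\<not> ?thesis"
    then have full: "\<exists>u. u \<in> words (length u) \<and> \<not> hole K u" for K
      by blast
    \<comment> \<open>Zooming needs full nodes that are also deep. A node full to relative depth
      \<open>n + n\<close> supplies one: any descendant \<open>n\<close> levels below it is still
      full to relative depth \<open>n\<close>.\<close>
    have "\<exists>u. u \<in> words (length u) \<and> n \<le> length u \<and> \<not> hole n u" for n
    proof -
      obtain u where u: "u \<in> words (length u)" "\<not> hole (n + n) u"
        using full[of "n + n"] by blast
      obtain x where "x \<in> E" using E_nonempty by blast
      then obtain v where v: "v \<in> words n" by (rule obtain_word)
      show ?thesis
      proof (intro exI[of _ "u @ v"] conjI)
        show "u @ v \<in> words (length (u @ v))"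
          using append_words[OF u(1) v] by (simp add: length_words[OF v])
        show "n \<le> length (u @ v)" by (simp add: length_words[OF v])
        show "\<not> hole n (u @ v)"
        proof
          assume "hole n (u @ v)"
          then obtain v' where v': "v' \<in> words n" "wmap ((u @ v) @ v') ` E \<inter> (f ` E \<inter> E) = {}"
            unfolding hole_def by blast
          then have "hole (n + n) u"
            unfolding hole_def by (intro bexI[of _ "v @ v'"] append_words[OF v]) simp_all
          then show False using u(2) by contradiction
        qed
      qed
    qed
    then obtain u where u: "\<And>n. u n \<in> words (length (u n))" "\<And>n. n \<le> length (u n)"
      and no_hole: "\<And>n. \<not> hole n (u n)"
      by metis
    have alive: "wmap (u n @ v) ` E \<inter> (f ` E \<inter> E) \<noteq> {}" if "v \<in> words n" for n v
      using no_hole[of n] that unfolding hole_def by blast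
    obtain x and M :: nat and D where x: "x \<in> E" "f x \<in> E"
      "E \<subseteq> (\<Union>j<M. (\<lambda>e. deriv f x * e + D j) ` E)"
      by (rule full_nodes_imp_affine_cover[OF assms(7) u alive])
    have "ln \<bar>deriv f x\<bar> / ln \<rho> \<in> \<rat>"
      by (rule affine_cover_imp_rational[OF negl C1_diffeomorphism_deriv_nonzero[OF assms(7)] x(3)])
    then show False using assms(8) x by simp
  qed
  then obtain K where K: "\<And>u. u \<in> words (length u) \<Longrightarrow> hole K u" by blast
  have "upper_minkowski_dim (f ` E \<inter> E) < ereal sim_dim"
    using K unfolding hole_def by (intro upper_minkowski_dim_less[of _ K]) auto
  also have "\<dots> \<le> hausdorff_dim E" by (rule sim_dim_le_hausdorff_dim)
  finally show ?thesis .
qed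

end
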